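(* Let $\{\mathbf{Y}\cup\{\Delta\},\mathbf{A},p\}$ be an MDP model (as described in the context) with $\mathbf{X}=\mathbf{Y}\cup\{\Delta\}$, satisfying Condition (S), and let $F$ be a nonempty finite subset of $\mathbf{X}$ such that the model is uniformly absorbing with initial state $x$ for each $x\in F$ (so that $\mathcal{D}^\Pi_F\subseteq\mathcal{M}(\mathbf{Y}\times\mathbf{A})$). Then the w-topology and the ws-topology on $\mathcal{D}^\Pi_F$ coincide.
   Context: An MDP model $\{\mathbf{X},\mathbf{A},p\}$ consists of nonempty topological Borel spaces $\mathbf{X}$ (states) and $\mathbf{A}$ (actions) with their Borel $\sigma$-algebras, and a stochastic kernel $p(dy|x,a)$ on $\mathcal{B}(\mathbf{X})$ given $\mathbf{X}\times\mathbf{A}$. Let $\mathbf{H}_0=\mathbf{X}$, $\mathbf{H}_n=(\mathbf{X}\times\mathbf{A})^n\times\mathbf{X}$, $\mathbf{H}=\mathbf{X}\times(\mathbf{A}\times\mathbf{X})^\infty$, $X_n(h)=x_n$, $A_{n+1}(h)=a_{n+1}$. A strategy is a sequence $\pi=\{\pi_n\}_{n\ge1}$ of stochastic kernels $\pi_n(da|h_{n-1})$ on $\mathcal{B}(\mathbf{A})$ given $\mathbf{H}_{n-1}$; $\Pi$ is the set of all strategies. For an initial state $x$ and $\pi\in\Pi$, $\mathbb{P}^\pi_{x}$ is the unique probability on $\mathbf{H}$ with $X_0=x$, conditional law of $A_{n+1}$ given $X_0,A_1,\dots,X_n$ equal to $\pi_{n+1}(\cdot|X_0,A_1,\dots,X_n)$,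 and conditional law of $X_{n+1}$ given $X_0,\dots,X_n,A_{n+1}$ equal to $p(\cdot|X_n,A_{n+1})$; $\mathbb{E}^\pi_{x}$ is its expectation. The model $\{\mathbf{Y}\cup\{\Delta\},\mathbf{A},p\}$ has $\mathbf{X}=\mathbf{Y}\cup\{\Delta\}$ with $\mathbf{Y}$ a Borel space, $\Delta$ an isolated point, and $p(\{\Delta\}|\Delta,a)=1$ for all $a$. Let $\tau=\inf\{n\ge0:X_n=\Delta\}$. The model is absorbing with initial state $x$ if $\mathbb{E}^\pi_x[\tau]<\infty$ for all $\pi\in\Pi$, and uniformly absorbing with initial state $x$ if in addition $\lim_{n\to\infty}\sup_{\pi\in\Pi}\mathbb{E}^\pi_{x}[\sum_{t=n}^\infty\mathbb{I}\{\tau>t\}]=0$. The occupation measure of $\pi$ with initial state $x$ is $\eta^\pi_{x}(dy\times da)=\mathbb{E}^\pi_{x}[\sum_{n=0}^\infty\mathbb{I}\{X_n\in dy,A_{n+1}\in da\}]$ on $\mathbf{Y}\times\mathbf{A}$, and $\mathcal{D}^\Pi_F=\{\eta^\pi_x:x\in F,\pi\in\Pi\}$. Condition (S): $\mathbf{A}$ is compact and for each bounded measurable $g$ on $\mathbf{X}$ and each $x\in\mathbf{X}$, $a\mapsto\int_{\mathbf{X}}g(y)p(dy|x,a)$ is continuous. On the space $\mathcal{M}(\mathbf{Y}\times\mathbf{A})$ of finite Borel measures: the w-topology is the coarsest topology making $\eta\mapsto\int g\,d\eta$ continuous for all bounded continuous $g$; the ws-topology is the coarsest topology making $\eta\mapsto\int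 g\,d\eta$ continuous for all bounded Carathéodory functions $g$, i.e. real measurable functions $g(y,a)$ continuous in $a$ for each fixed $y\in\mathbf{Y}$. Topologies on $\mathcal{D}^\Pi_F$ are the relative ones. *)

theory Defs
  imports "HOL-Probability.Probability"
begin

text \<open>
  Conventions.  States live in a Polish type 'x, actions in a Polish type 'a.
  The state space is the Borel set X = Y \<union> {\<Delta>}, the action space is the Borel set A,
  both equipped with the subspace topology and their Borel sigma-algebras.
  The finite history h_n = (x_0,a_1,x_1,...,a_n,x_n) is represented as a pair (f, x_n)
  with f i = (x_i, a_(i+1)) for i < n (an element of the finite product PiM {..<n}).
  A strategy is pi :: nat => history => action-measure, where pi n is the kernel
  choosing a_(n+1) given h_n (the paper's pi_(n+1)).
\<close>

definition stateM :: "'x::topological_space set \<Rightarrow> 'x measure" where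
  "stateM X = restrict_space borel X"

definition histM :: "'x::topological_space set \<Rightarrow> 'a::topological_space set \<Rightarrow> nat
    \<Rightarrow> ((nat \<Rightarrow> 'x \<times> 'a) \<times> 'x) measure" where
  "histM X A n = (PiM {..<n} (\<lambda>_. stateM X \<Otimes>\<^sub>M stateM A)) \<Otimes>\<^sub>M stateM X"

definition strategies :: "'x::topological_space set \<Rightarrow> 'a::topological_space set
    \<Rightarrow> (nat \<Rightarrow> (nat \<Rightarrow> 'x \<times> 'a) \<times> 'x \<Rightarrow> 'a measure) set" where
  "strategies X A = {\<pi>. \<forall>n. \<pi> n \<in> measurable (histM X A n) (prob_algebra (stateM A))}"

text \<open>Law of the history h_n = (X_0,A_1,...,X_n) under P^\<pi>_x (finite-dimensional
  distributions of the strategic measure, built by iterating the kernels).\<close>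
fun hist_law :: "'x::topological_space set \<Rightarrow> 'a::topological_space set
    \<Rightarrow> ('x \<Rightarrow> 'a \<Rightarrow> 'x measure) \<Rightarrow> (nat \<Rightarrow> (nat \<Rightarrow> 'x \<times> 'a) \<times> 'x \<Rightarrow> 'a measure)
    \<Rightarrow> 'x \<Rightarrow> nat \<Rightarrow> ((nat \<Rightarrow> 'x \<times> 'a) \<times> 'x) measure" where
  "hist_law X A p \<pi> x 0 = return (histM X A 0) (\<lambda>_. undefined, x)"
| "hist_law X A p \<pi> x (Suc n) =
     hist_law X A p \<pi> x n \<bind> (\<lambda>(f, y). \<pi> n (f, y) \<bind> (\<lambda>a. p y a \<bind>
        (\<lambda>z. return (histM X A (Suc n)) (f(n := (y, a)), z))))"

definition pair_law :: "'x::topological_space set \<Rightarrow> 'a::topological_space set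
    \<Rightarrow> ('x \<Rightarrow> 'a \<Rightarrow> 'x measure) \<Rightarrow> (nat \<Rightarrow> (nat \<Rightarrow> 'x \<times> 'a) \<times> 'x \<Rightarrow> 'a measure)
    \<Rightarrow> 'x \<Rightarrow> nat \<Rightarrow> ('x \<times> 'a) measure" where
  "pair_law X A p \<pi> x n = hist_law X A p \<pi> x n \<bind>
     (\<lambda>(f, y). distr (\<pi> n (f, y)) (stateM X \<Otimes>\<^sub>M stateM A) (\<lambda>a. (y, a)))"

text \<open>P^\<pi>_x(\<tau> > t) = P^\<pi>_x(X_0 \<noteq> \<Delta>, ..., X_t \<noteq> \<Delta>).\<close>
definition surv_prob :: "'x::topological_space set \<Rightarrow> 'a::topological_space set
    \<Rightarrow> ('x \<Rightarrow> 'a \<Rightarrow> 'x measure) \<Rightarrow> 'x \<Rightarrow> (nat \<Rightarrow> (nat \<Rightarrow> 'x \<times> 'a) \<times> 'x \<Rightarrow> 'a measure)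
    \<Rightarrow> 'x \<Rightarrow> nat \<Rightarrow> ennreal" where
  "surv_prob X A p \<Delta> \<pi> x t = emeasure (hist_law X A p \<pi> x t)
     {h \<in> space (histM X A t). (\<forall>i<t. fst (fst h i) \<noteq> \<Delta>) \<and> snd h \<noteq> \<Delta>}"

text \<open>Absorbing: E^\<pi>_x[\<tau>] = E^\<pi>_x[\<Sum>_t I{\<tau>>t}] = \<Sum>_t P^\<pi>_x(\<tau>>t) < \<infinity> for all \<pi>.\<close>
definition absorbing :: "'x::topological_space set \<Rightarrow> 'a::topological_space set
    \<Rightarrow> ('x \<Rightarrow> 'a \<Rightarrow> 'x measure) \<Rightarrow> 'x \<Rightarrow> 'x \<Rightarrow> bool" where
  "absorbing X A p \<Delta> x \<longleftrightarrow>
     (\<forall>\<pi>\<in>strategies X A. (\<Sum>t. surv_prob X A p \<Delta> \<pi> x t) < \<infinity>)"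

text \<open>Uniformly absorbing: additionally
  sup_\<pi> E^\<pi>_x[\<Sum>_(t\<ge>n) I{\<tau>>t}] = sup_\<pi> \<Sum>_(t\<ge>n) P^\<pi>_x(\<tau>>t) \<rightarrow> 0.\<close>
definition uniformly_absorbing :: "'x::topological_space set \<Rightarrow> 'a::topological_space set
    \<Rightarrow> ('x \<Rightarrow> 'a \<Rightarrow> 'x measure) \<Rightarrow> 'x \<Rightarrow> 'x \<Rightarrow> bool" where
  "uniformly_absorbing X A p \<Delta> x \<longleftrightarrow> absorbing X A p \<Delta> x \<and>
     ((\<lambda>n. SUP \<pi>\<in>strategies X A. (\<Sum>t. surv_prob X A p \<Delta> \<pi> x (t + n))) \<longlongrightarrow> 0) sequentially"

text \<open>Occupation measure \<eta>^\<pi>_x on Y \<times> A: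
  \<eta>(C) = E[\<Sum>_n I{(X_n,A_(n+1)) \<in> C}] = \<Sum>_n P(X_n,A_(n+1)) \<in> C).\<close>
definition occupation :: "'x::topological_space set \<Rightarrow> 'x set \<Rightarrow> 'a::topological_space set
    \<Rightarrow> ('x \<Rightarrow> 'a \<Rightarrow> 'x measure) \<Rightarrow> (nat \<Rightarrow> (nat \<Rightarrow> 'x \<times> 'a) \<times> 'x \<Rightarrow> 'a measure)
    \<Rightarrow> 'x \<Rightarrow> ('x \<times> 'a) measure" where
  "occupation X Y A p \<pi> x = measure_of (space (stateM Y \<Otimes>\<^sub>M stateM A))
     (sets (stateM Y \<Otimes>\<^sub>M stateM A)) (\<lambda>C. \<Sum>n. emeasure (pair_law X A p \<pi> x n) C)"

definition occupation_set :: "'x::topological_space set \<Rightarrow> 'x set \<Rightarrow> 'a::topological_space set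
    \<Rightarrow> ('x \<Rightarrow> 'a \<Rightarrow> 'x measure) \<Rightarrow> 'x set \<Rightarrow> ('x \<times> 'a) measure set" where
  "occupation_set X Y A p F = {occupation X Y A p \<pi> x | x \<pi>. x \<in> F \<and> \<pi> \<in> strategies X A}"

definition finite_measures :: "'x::topological_space set \<Rightarrow> 'a::topological_space set
    \<Rightarrow> ('x \<times> 'a) measure set" where
  "finite_measures Y A = {\<mu>. sets \<mu> = sets (stateM Y \<Otimes>\<^sub>M stateM A) \<and> finite_measure \<mu>}"

definition integral_topology :: "'x::topological_space set \<Rightarrow> 'a::topological_space set
    \<Rightarrow> ('x \<times> 'a \<Rightarrow> real) set \<Rightarrow> ('x \<times> 'a) measure topology" where
  "integral_topology Y A G = topology_generated_by
     {{\<mu> \<in> finite_measures Y A. (\<integral>z. g z \<partial>\<mu>) \<in> U} | g U. g \<in> G \<and> open U}"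

definition bcont_funs :: "'x::topological_space set \<Rightarrow> 'a::topological_space set
    \<Rightarrow> ('x \<times> 'a \<Rightarrow> real) set" where
  "bcont_funs Y A = {g. continuous_on (Y \<times> A) g \<and> bounded (g ` (Y \<times> A))}"

definition bcarath_funs :: "'x::topological_space set \<Rightarrow> 'a::topological_space set
    \<Rightarrow> ('x \<times> 'a \<Rightarrow> real) set" where
  "bcarath_funs Y A = {g. g \<in> borel_measurable (stateM Y \<Otimes>\<^sub>M stateM A) \<and>
      (\<forall>y\<in>Y. continuous_on A (\<lambda>a. g (y, a))) \<and> bounded (g ` (Y \<times> A))}"

definition w_topology where "w_topology Y A = integral_topology Y A (bcont_funs Y A)"
definition ws_topology where "ws_topology Y A = integral_topology Y A (bcarath_funs Y A)"

definition condition_S :: "'x::topological_space set \<Rightarrow> 'a::topological_space set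
    \<Rightarrow> ('x \<Rightarrow> 'a \<Rightarrow> 'x measure) \<Rightarrow> bool" where
  "condition_S X A p \<longleftrightarrow> compact A \<and>
     (\<forall>g::'x \<Rightarrow> real. g \<in> borel_measurable (stateM X) \<and> bounded (g ` X) \<longrightarrow>
        (\<forall>x\<in>X. continuous_on A (\<lambda>a. \<integral>y. g y \<partial>(p x a))))"

end

theory Submission
  imports Defs
begin

text \<open>
  The integral of a bounded Caratheodory function \<open>g\<close> is, on the set of occupation measures, a uniform limit
  of integrals of bounded continuous functions, hence continuous in the w-topology.

  The reason is that the state marginals of the occupation measures are uniformly continuous from above:
  if measurable functions \<open>0 \<le> f n \<le> 1\<close> decrease to 0 on \<open>Y\<close>, then their integrals tend to 0 uniformly
  over all strategies. Indeed, with \<open>T f y = sup\<^sub>a \<integral> f(z) p(dz|y,a)\<close>, the expectation of \<open>f(X\<^sub>t)\<close> is at most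
  \<open>T\<^sup>t f (x)\<close>, and by Condition (S) and Dini's theorem \<open>T\<close> maps sequences decreasing to 0 to such sequences;
  uniform absorption disposes of all but finitely many times \<open>t\<close>.

  Uniform continuity from above lets Lusin-type approximation run simultaneously for the whole family:
  a monotone class argument approximates bounded measurable functions of the state by continuous ones, and a
  partition of unity on the compact set \<open>A\<close> reduces Caratheodory functions to that case.
\<close>

text \<open>Only one inclusion of topologies has content, since bounded continuous functions are
  bounded Caratheodory functions. The obstacle in the other is that a continuous approximation in
  mean normally depends on the measure, while here one approximation has to serve a family indexed
  by all strategies.

  Monotone sequences carry the argument because a supremum over actions need not commute with a
  pointwise limit. For a fixed state, the integrals of \<open>f n\<close> against the kernel are
  continuous in the action and decrease to 0 on a compact set, hence uniformly in the action. As
  \<open>T\<close> also preserves measurability, the bound 1 and monotonicity, this can be repeated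
  at every time. A strategy may use the whole history, but it only averages over actions in each
  transition, so \<open>T\<close> bounds its effect.

  At late times \<open>f \<le> 1\<close> leaves the probability of being in \<open>Y\<close>,
  whereas absorption controls the probability of never having met \<open>\<Delta>\<close>. The two
  agree because leaving \<open>\<Delta>\<close> has probability 0.\<close>

lemma space_stateM [simp]: "space (stateM X) = X"
  by (simp add: stateM_def space_restrict_space)

subsection \<open>Families with uniformly continuous state marginals\<close>

lemma continuous_on_measurable_stateM:
  fixes f :: "'x::topological_space \<Rightarrow> real"
  shows "continuous_on Y f \<Longrightarrow> f \<in> borel_measurable (stateM Y)"
  unfolding stateM_def by (rule borel_measurable_continuous_on_restrict)

text \<open>Polish spaces are second countable, so the product of the Borel sigma-algebras is the
  Borel sigma-algebra of the product (\<open>borel_prod\<close>), and joint continuity is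
  enough.\<close>

lemma bcont_funs_measurable:
  fixes Y :: "'x::polish_space set" and A :: "'a::polish_space set"
  assumes "continuous_on (Y \<times> A) g"
  shows "(g :: _ \<Rightarrow> real) \<in> borel_measurable (stateM Y \<Otimes>\<^sub>M stateM A)"
proof -
  have Y: "(\<lambda>x. x) \<in> stateM Y \<rightarrow>\<^sub>M borel" and A: "(\<lambda>x. x) \<in> stateM A \<rightarrow>\<^sub>M borel"
    unfolding stateM_def by (auto intro: measurable_restrict_space1)
  have "(\<lambda>w. (fst w, snd w)) \<in> stateM Y \<Otimes>\<^sub>M stateM A \<rightarrow>\<^sub>M borel \<Otimes>\<^sub>M borel"
    by (rule measurable_Pair[OF measurable_compose[OF measurable_fst Y] measurable_compose[OF measurable_snd A]])
  then have "(\<lambda>w. w) \<in> stateM Y \<Otimes>\<^sub>M stateM A \<rightarrow>\<^sub>M restrict_space borel (Y \<times> A)"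
    by (intro measurable_restrict_space2)
      (auto simp: borel_prod space_pair_measure stateM_def space_restrict_space)
  then show ?thesis
    using measurable_compose borel_measurable_continuous_on_restrict[OF assms] by blast
qed

lemma bcont_subset_bcarath:
  fixes Y :: "'x::polish_space set" and A :: "'a::polish_space set"
  shows "bcont_funs Y A \<subseteq> bcarath_funs Y A"
proof
  fix g assume "g \<in> bcont_funs Y A"
  then have g: "continuous_on (Y \<times> A) g" "bounded (g ` (Y \<times> A))" by (auto simp: bcont_funs_def)
  have "continuous_on A (\<lambda>a. g (y, a))" if "y \<in> Y" for y
    by (rule continuous_on_compose2[OF g(1)]) (use that in \<open>auto intro!: continuous_intros\<close>)
  then show "g \<in> bcarath_funs Y A"
    using g bcont_funs_measurable[OF g(1)] by (simp add: bcarath_funs_def)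
qed

text \<open>Tent functions of radius \<open>e\<close> around the points of a finite
  \<open>e\<close>-net, divided by their sum. The sum is positive on \<open>A\<close> because the
  balls around the net cover \<open>A\<close>.\<close>

lemma compact_partition_of_unity:
  fixes A :: "'a::metric_space set"
  assumes "compact A" "0 < e"
  obtains K and \<psi> :: "'a \<Rightarrow> 'a \<Rightarrow> real" where "finite K" "K \<subseteq> A" "\<And>k. continuous_on A (\<psi> k)"
    "\<And>k a. 0 \<le> \<psi> k a" "\<And>a. a \<in> A \<Longrightarrow> (\<Sum>k\<in>K. \<psi> k a) = 1" "\<And>k a. \<psi> k a \<noteq> 0 \<Longrightarrow> dist k a < e"
proof -
  have "A \<subseteq> (\<Union>x\<in>A. ball x e)" using assms(2) by auto
  then obtain K where K: "K \<subseteq> A" "finite K" "A \<subseteq> (\<Union>x\<in>K. ball x e)"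
    by (rule compactE_image[OF assms(1) open_ball])
  define b where "b k a = max 0 (e - dist k a)" for k a :: 'a
  define s where "s a = (\<Sum>k\<in>K. b k a)" for a
  have b: "0 \<le> b k a" for k a by (simp add: b_def)
  have s_pos: "0 < s a" if a: "a \<in> A" for a
  proof -
    obtain k where "k \<in> K" "dist k a < e" using K(3) a by auto
    then show ?thesis unfolding s_def using K(2) b by (intro sum_pos2[of K k]) (auto simp: b_def)
  qed
  have s: "0 \<le> s a" for a unfolding s_def using b by (intro sum_nonneg) auto
  show thesis
  \<comment> \<open>Off \<open>A\<close> the sum \<open>s\<close> may vanish; division by 0 then
    gives 0, so the sign and support conditions hold on the whole type.\<close>
  proof (rule that[of K "\<lambda>k a. b k a / s a"])
    show "continuous_on A (\<lambda>a. b k a / s a)" for k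
    proof (rule continuous_on_divide)
      show "continuous_on A (b k)" for k unfolding b_def by (intro continuous_intros)
      then show "continuous_on A s" unfolding s_def by (intro continuous_on_sum)
      show "\<forall>a\<in>A. s a \<noteq> 0" using s_pos by force
    qed
    show "(\<Sum>k\<in>K. b k a / s a) = 1" if "a \<in> A" for a
      using s_pos[OF that] by (simp add: sum_divide_distrib[symmetric] s_def)
    show "dist k a < e" if "b k a / s a \<noteq> 0" for k a
      using that by (auto simp: b_def max_def split: if_splits)
  qed (use K b s in auto)
qed

text \<open>The assumption \<open>vanish\<close> is continuity from above of the state marginals, uniformly over the family.
  It replaces domination by a single finite measure in Lusin-type arguments.\<close>
locale vanishing_family =
  fixes Y :: "'x::polish_space set" and A :: "'a::polish_space set" and D :: "('x \<times> 'a) measure set"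
  assumes Y_borel: "Y \<in> sets borel" and compact_A: "compact A"
    and sets_D: "\<And>\<eta>. \<eta> \<in> D \<Longrightarrow> sets \<eta> = sets (stateM Y \<Otimes>\<^sub>M stateM A)"
    and vanish: "\<And>(f :: nat \<Rightarrow> 'x \<Rightarrow> ennreal) e. (\<And>n. f n \<in> borel_measurable (stateM Y)) \<Longrightarrow>
      (\<And>n z. z \<in> Y \<Longrightarrow> f n z \<le> 1) \<Longrightarrow> (\<And>m n z. z \<in> Y \<Longrightarrow> m \<le> n \<Longrightarrow> f n z \<le> f m z) \<Longrightarrow>
      (\<And>z. z \<in> Y \<Longrightarrow> (\<lambda>n. f n z) \<longlonglongrightarrow> 0) \<Longrightarrow> 0 < e \<Longrightarrow>
      \<exists>n. \<forall>\<eta>\<in>D. (\<integral>\<^sup>+w. f n (fst w) \<partial>\<eta>) < e"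
begin

lemma space_D: "\<eta> \<in> D \<Longrightarrow> space \<eta> = Y \<times> A"
  using sets_eq_imp_space_eq[OF sets_D] by (simp add: space_pair_measure stateM_def space_restrict_space)

lemma fst_measurable_D:
  assumes "\<eta> \<in> D" "f \<in> borel_measurable (stateM Y)"
  shows "(\<lambda>w. f (fst w)) \<in> borel_measurable \<eta>"
proof -
  have "(\<lambda>w. f (fst w)) \<in> borel_measurable (stateM Y \<Otimes>\<^sub>M stateM A)"
    by (rule measurable_compose[OF measurable_fst assms(2)])
  then show ?thesis using measurable_cong_sets[OF sets_D[OF assms(1)] refl] by blast
qed

text \<open>Passes from monotone to dominated sequences: the tail suprema \<open>s n\<close> lie
  above \<open>h n\<close>, inherit the bound, and decrease to 0 wherever \<open>h n\<close> tends
  to 0. Scaling by \<open>c\<close> brings them below 1, as \<open>vanish\<close> demands.\<close>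

lemma vanish_dominated:
  fixes h :: "nat \<Rightarrow> 'x \<Rightarrow> ennreal"
  assumes h: "\<And>n. h n \<in> borel_measurable (stateM Y)" and le: "\<And>n z. z \<in> Y \<Longrightarrow> h n z \<le> ennreal C"
    and lim: "\<And>z. z \<in> Y \<Longrightarrow> (\<lambda>n. h n z) \<longlonglongrightarrow> 0" and e: "0 < e"
  shows "\<exists>n. \<forall>\<eta>\<in>D. (\<integral>\<^sup>+w. h n (fst w) \<partial>\<eta>) < e"
proof -
  \<comment> \<open>\<open>C\<close> may be 0 or negative; the maximum keeps \<open>1 / B\<close>
    positive and finite.\<close>
  define B where "B = max C 1"
  define c where "c = ennreal (1 / B)"
  have B: "1 \<le> B" "C \<le> B" by (auto simp: B_def)
  have cB: "c * ennreal B = 1" using B(1) by (simp add: c_def ennreal_mult'[symmetric])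
  have c0: "0 < c" "c < top" using B(1) by (auto simp: c_def)
  define s where "s n z = (SUP m\<in>{n..}. h m z)" for n z
  have s: "s n \<in> borel_measurable (stateM Y)" for n
    unfolding s_def[abs_def] by (rule borel_measurable_SUP) (use h in auto)
  have s_lim: "(\<lambda>n. s n z) \<longlonglongrightarrow> 0" if z: "z \<in> Y" for z
  proof (rule order_tendstoI)
    fix d :: ennreal assume "0 < d"
    \<comment> \<open>A supremum of values below \<open>d'\<close> is only at most
      \<open>d'\<close>, so room is kept below \<open>d\<close>. The same device recurs in the later
      limits of suprema.\<close>
    then obtain d' where d': "0 < d'" "d' < d" using dense by blast
    obtain N where N: "\<And>n. n \<ge> N \<Longrightarrow> h n z < d'"
      using order_tendstoD(2)[OF lim[OF z] d'(1)] by (auto simp: eventually_sequentially)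
    have "s n z < d" if "n \<ge> N" for n
    proof -
      have "s n z \<le> d'" unfolding s_def
        by (rule SUP_least) (use N that in \<open>auto intro: less_imp_le\<close>)
      then show ?thesis using d' by simp
    qed
    then show "\<forall>\<^sub>F n in sequentially. s n z < d" by (auto simp: eventually_sequentially)
  qed auto
  have "\<exists>n. \<forall>\<eta>\<in>D. (\<integral>\<^sup>+w. c * s n (fst w) \<partial>\<eta>) < c * e"
  proof (rule vanish)
    show "(\<lambda>z. c * s n z) \<in> borel_measurable (stateM Y)" for n using s by measurable
    show "c * s n z \<le> 1" if "z \<in> Y" for n z
    proof -
      have "s n z \<le> ennreal B" unfolding s_def using le[OF that] B(2)
        by (intro SUP_least) (meson ennreal_leI order_trans)
      then have "c * s n z \<le> c * ennreal B" by (rule mult_left_mono) simp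
      then show ?thesis by (simp add: cB)
    qed
    show "c * s n z \<le> c * s m z" if "m \<le> n" for m n z
      unfolding s_def using that by (intro mult_left_mono SUP_subset_mono) auto
    show "(\<lambda>n. c * s n z) \<longlonglongrightarrow> 0" if "z \<in> Y" for z
      using ennreal_tendsto_cmult[OF c0(2) s_lim[OF that]] by simp
    show "0 < c * e" using c0 e by (simp add: ennreal_zero_less_mult_iff)
  qed
  then obtain n where n: "\<And>\<eta>. \<eta> \<in> D \<Longrightarrow> (\<integral>\<^sup>+w. c * s n (fst w) \<partial>\<eta>) < c * e" by blast
  have "(\<integral>\<^sup>+w. h n (fst w) \<partial>\<eta>) < e" if \<eta>: "\<eta> \<in> D" for \<eta>
  proof -
    have "(\<integral>\<^sup>+w. c * s n (fst w) \<partial>\<eta>) = c * (\<integral>\<^sup>+w. s n (fst w) \<partial>\<eta>)"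
      by (rule nn_integral_cmult[OF fst_measurable_D[OF \<eta> s]])
    with n[OF \<eta>] have "c * (\<integral>\<^sup>+w. s n (fst w) \<partial>\<eta>) < c * e" by simp
    then have "(\<integral>\<^sup>+w. s n (fst w) \<partial>\<eta>) < e"
      using mult_left_mono[of e "\<integral>\<^sup>+w. s n (fst w) \<partial>\<eta>" c] by (auto simp: not_le[symmetric])
    moreover have "(\<integral>\<^sup>+w. h n (fst w) \<partial>\<eta>) \<le> (\<integral>\<^sup>+w. s n (fst w) \<partial>\<eta>)"
      unfolding s_def by (intro nn_integral_mono SUP_upper) auto
    ultimately show ?thesis by (rule le_less_trans[rotated])
  qed
  then show ?thesis by blast
qed

section \<open>Uniform mean approximation of functions of the state\<close>

text \<open>This is membership in the closure of the bounded continuous functions of the state under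
  the seminorm that takes the supremum over \<open>D\<close> of the L1 norms. The lemmas below show
  that this closure is a vector space, is stable under dominated limits, and contains all bounded
  measurable functions.\<close>

definition approx :: "('x \<Rightarrow> real) \<Rightarrow> bool" where
  "approx f \<longleftrightarrow> f \<in> borel_measurable (stateM Y) \<and> (\<forall>e>0. \<exists>\<phi>. continuous_on Y \<phi> \<and> bounded (\<phi> ` Y) \<and>
     (\<forall>\<eta>\<in>D. (\<integral>\<^sup>+w. ennreal \<bar>f (fst w) - \<phi> (fst w)\<bar> \<partial>\<eta>) \<le> ennreal e))"

lemma approxD:
  assumes "approx f" "0 < e"
  obtains \<phi> where "continuous_on Y \<phi>" "bounded (\<phi> ` Y)"
    "\<And>\<eta>. \<eta> \<in> D \<Longrightarrow> (\<integral>\<^sup>+w. ennreal \<bar>f (fst w) - \<phi> (fst w)\<bar> \<partial>\<eta>) \<le> ennreal e"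
  using assms unfolding approx_def by blast

lemma approx_measurable: "approx f \<Longrightarrow> f \<in> borel_measurable (stateM Y)"
  by (simp add: approx_def)

lemma approx_continuous: "continuous_on Y f \<Longrightarrow> bounded (f ` Y) \<Longrightarrow> approx f"
  unfolding approx_def using continuous_on_measurable_stateM by (auto intro!: exI[of _ f])

lemma approx_const: "approx (\<lambda>_. c)"
  by (rule approx_continuous) (auto simp: bounded_iff intro!: exI[of _ "\<bar>c\<bar>"])

lemma approx_cong:
  assumes "approx f" "\<And>y. y \<in> Y \<Longrightarrow> f y = g y"
  shows "approx g"
proof -
  have "g \<in> borel_measurable (stateM Y)"
    using approx_measurable[OF assms(1)] assms(2)
    by (subst measurable_cong[of _ _ f]) (auto simp: stateM_def space_restrict_space)
  moreover have "(\<integral>\<^sup>+w. ennreal \<bar>f (fst w) - \<phi> (fst w)\<bar> \<partial>\<eta>) = (\<integral>\<^sup>+w. ennreal \<bar>g (fst w) - \<phi> (fst w)\<bar> \<partial>\<eta>)"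
    if "\<eta> \<in> D" for \<eta> \<phi>
    using assms(2) space_D[OF that] by (intro nn_integral_cong) auto
  ultimately show ?thesis using assms(1) unfolding approx_def by simp
qed

lemma nn_integral_triangle_D:
  assumes \<eta>: "\<eta> \<in> D" and f: "f \<in> borel_measurable (stateM Y)" and g: "g \<in> borel_measurable (stateM Y)"
    and le: "\<And>y. y \<in> Y \<Longrightarrow> \<bar>h y\<bar> \<le> \<bar>f y\<bar> + \<bar>g y :: real\<bar>"
  shows "(\<integral>\<^sup>+w. ennreal \<bar>h (fst w)\<bar> \<partial>\<eta>) \<le> (\<integral>\<^sup>+w. ennreal \<bar>f (fst w)\<bar> \<partial>\<eta>) + (\<integral>\<^sup>+w. ennreal \<bar>g (fst w)\<bar> \<partial>\<eta>)"
proof -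
  have "(\<integral>\<^sup>+w. ennreal \<bar>h (fst w)\<bar> \<partial>\<eta>) \<le> (\<integral>\<^sup>+w. ennreal \<bar>f (fst w)\<bar> + ennreal \<bar>g (fst w)\<bar> \<partial>\<eta>)"
    using le space_D[OF \<eta>] by (intro nn_integral_mono) (auto simp: ennreal_plus[symmetric] simp del: ennreal_plus intro!: ennreal_leI)
  also have "\<dots> = (\<integral>\<^sup>+w. ennreal \<bar>f (fst w)\<bar> \<partial>\<eta>) + (\<integral>\<^sup>+w. ennreal \<bar>g (fst w)\<bar> \<partial>\<eta>)"
    by (intro nn_integral_add) (use fst_measurable_D[OF \<eta> f] fst_measurable_D[OF \<eta> g] in measurable)
  finally show ?thesis .
qed

lemma approx_add:
  assumes f: "approx f" and g: "approx g"
  shows "approx (\<lambda>y. f y + g y)"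
  unfolding approx_def
proof (intro conjI allI impI)
  note [measurable] = approx_measurable[OF f] approx_measurable[OF g]
  show "(\<lambda>y. f y + g y) \<in> borel_measurable (stateM Y)" by measurable
  fix e :: real assume "0 < e"
  then have e2: "0 < e / 2" by simp
  from approxD[OF f e2] obtain \<phi> where \<phi>: "continuous_on Y \<phi>" "bounded (\<phi> ` Y)"
    "\<And>\<eta>. \<eta> \<in> D \<Longrightarrow> (\<integral>\<^sup>+w. ennreal \<bar>f (fst w) - \<phi> (fst w)\<bar> \<partial>\<eta>) \<le> ennreal (e / 2)" by blast
  from approxD[OF g e2] obtain \<psi> where \<psi>: "continuous_on Y \<psi>" "bounded (\<psi> ` Y)"
    "\<And>\<eta>. \<eta> \<in> D \<Longrightarrow> (\<integral>\<^sup>+w. ennreal \<bar>g (fst w) - \<psi> (fst w)\<bar> \<partial>\<eta>) \<le> ennreal (e / 2)" by blast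
  note [measurable] = continuous_on_measurable_stateM[OF \<phi>(1)] continuous_on_measurable_stateM[OF \<psi>(1)]
  have "(\<integral>\<^sup>+w. ennreal \<bar>f (fst w) + g (fst w) - (\<phi> (fst w) + \<psi> (fst w))\<bar> \<partial>\<eta>) \<le> ennreal e" if \<eta>: "\<eta> \<in> D" for \<eta>
  proof -
    have m1: "(\<lambda>y. f y - \<phi> y) \<in> borel_measurable (stateM Y)"
      and m2: "(\<lambda>y. g y - \<psi> y) \<in> borel_measurable (stateM Y)" by measurable
    have "(\<integral>\<^sup>+w. ennreal \<bar>f (fst w) + g (fst w) - (\<phi> (fst w) + \<psi> (fst w))\<bar> \<partial>\<eta>) \<le>
       (\<integral>\<^sup>+w. ennreal \<bar>f (fst w) - \<phi> (fst w)\<bar> \<partial>\<eta>) + (\<integral>\<^sup>+w. ennreal \<bar>g (fst w) - \<psi> (fst w)\<bar> \<partial>\<eta>)"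
      by (rule nn_integral_triangle_D[OF \<eta>, of "\<lambda>y. f y - \<phi> y" "\<lambda>y. g y - \<psi> y" "\<lambda>y. f y + g y - (\<phi> y + \<psi> y)", OF m1 m2])
        linarith
    also have "\<dots> \<le> ennreal (e / 2) + ennreal (e / 2)"
      using \<phi>(3)[OF \<eta>] \<psi>(3)[OF \<eta>] by (rule add_mono)
    also have "\<dots> = ennreal e" using e2 by (simp add: ennreal_plus[symmetric] del: ennreal_plus)
    finally show ?thesis .
  qed
  moreover have "bounded ((\<lambda>y. \<phi> y + \<psi> y) ` Y)"
    using bounded_plus_comp[OF \<phi>(2) \<psi>(2)] .
  ultimately show "\<exists>\<phi>. continuous_on Y \<phi> \<and> bounded (\<phi> ` Y) \<and>
     (\<forall>\<eta>\<in>D. (\<integral>\<^sup>+w. ennreal \<bar>f (fst w) + g (fst w) - \<phi> (fst w)\<bar> \<partial>\<eta>) \<le> ennreal e)"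
    using continuous_on_add[OF \<phi>(1) \<psi>(1)] by (intro exI[of _ "\<lambda>y. \<phi> y + \<psi> y"]) auto
qed

lemma approx_cmult:
  assumes f: "approx f"
  shows "approx (\<lambda>y. c * f y)"
  unfolding approx_def
proof (intro conjI allI impI)
  note [measurable] = approx_measurable[OF f]
  show "(\<lambda>y. c * f y) \<in> borel_measurable (stateM Y)" by measurable
  fix e :: real assume e: "0 < e"
  \<comment> \<open>Adding 1 in the denominator covers \<open>c = 0\<close>.\<close>
  then have "0 < e / (\<bar>c\<bar> + 1)" by simp
  from approxD[OF f this] obtain \<phi> where \<phi>: "continuous_on Y \<phi>" "bounded (\<phi> ` Y)"
    "\<And>\<eta>. \<eta> \<in> D \<Longrightarrow> (\<integral>\<^sup>+w. ennreal \<bar>f (fst w) - \<phi> (fst w)\<bar> \<partial>\<eta>) \<le> ennreal (e / (\<bar>c\<bar> + 1))" by blast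
  note [measurable] = continuous_on_measurable_stateM[OF \<phi>(1)]
  have "(\<integral>\<^sup>+w. ennreal \<bar>c * f (fst w) - c * \<phi> (fst w)\<bar> \<partial>\<eta>) \<le> ennreal e" if \<eta>: "\<eta> \<in> D" for \<eta>
  proof -
    have m: "(\<lambda>w. ennreal \<bar>f (fst w) - \<phi> (fst w)\<bar>) \<in> borel_measurable \<eta>"
      by (rule fst_measurable_D[OF \<eta>, of "\<lambda>y. ennreal \<bar>f y - \<phi> y\<bar>"]) measurable
    have "(\<integral>\<^sup>+w. ennreal \<bar>c * f (fst w) - c * \<phi> (fst w)\<bar> \<partial>\<eta>) =
       (\<integral>\<^sup>+w. ennreal \<bar>c\<bar> * ennreal \<bar>f (fst w) - \<phi> (fst w)\<bar> \<partial>\<eta>)"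
      by (simp add: ennreal_mult'[symmetric] abs_mult[symmetric] right_diff_distrib)
    also have "\<dots> = ennreal \<bar>c\<bar> * (\<integral>\<^sup>+w. ennreal \<bar>f (fst w) - \<phi> (fst w)\<bar> \<partial>\<eta>)"
      by (rule nn_integral_cmult[OF m])
    also have "\<dots> \<le> ennreal \<bar>c\<bar> * ennreal (e / (\<bar>c\<bar> + 1))"
      using \<phi>(3)[OF \<eta>] by (rule mult_left_mono) simp
    also have "\<dots> = ennreal (\<bar>c\<bar> * (e / (\<bar>c\<bar> + 1)))" by (rule ennreal_mult'[symmetric]) simp
    also have "\<dots> \<le> ennreal e"
      using e by (intro ennreal_leI) (simp add: field_simps)
    finally show ?thesis .
  qed
  moreover have "bounded ((\<lambda>y. c * \<phi> y) ` Y)"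
    using bounded_scaling[OF \<phi>(2), of c] by (simp add: image_image)
  ultimately show "\<exists>\<phi>. continuous_on Y \<phi> \<and> bounded (\<phi> ` Y) \<and>
     (\<forall>\<eta>\<in>D. (\<integral>\<^sup>+w. ennreal \<bar>c * f (fst w) - \<phi> (fst w)\<bar> \<partial>\<eta>) \<le> ennreal e)"
    using continuous_on_mult_left[OF \<phi>(1), of c] by (intro exI[of _ "\<lambda>y. c * \<phi> y"]) auto
qed

text \<open>The errors \<open>\<bar>f - fn n\<bar>\<close> are dominated by \<open>C\<close> and
  tend to 0 pointwise, so \<open>vanish_dominated\<close> makes one of them small in mean for all of
  \<open>D\<close> at once; \<open>approx (fn n)\<close> then supplies the other half of
  \<open>e\<close>. This is where uniform continuity from above does the work of dominated
  convergence.\<close>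

lemma approx_limit:
  assumes fn: "\<And>n. approx (fn n)" and f: "f \<in> borel_measurable (stateM Y)"
    and C: "\<And>n y. y \<in> Y \<Longrightarrow> \<bar>f y - fn n y\<bar> \<le> C"
    and lim: "\<And>y. y \<in> Y \<Longrightarrow> (\<lambda>n. fn n y) \<longlonglongrightarrow> f y"
  shows "approx f"
  unfolding approx_def
proof (intro conjI allI impI f)
  note [measurable] = f approx_measurable[OF fn]
  fix e :: real assume "0 < e"
  then have e2: "0 < e / 2" by simp
  have "\<exists>n. \<forall>\<eta>\<in>D. (\<integral>\<^sup>+w. ennreal \<bar>f (fst w) - fn n (fst w)\<bar> \<partial>\<eta>) < ennreal (e / 2)"
  proof (rule vanish_dominated[of "\<lambda>n y. ennreal \<bar>f y - fn n y\<bar>" C])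
    show "(\<lambda>y. ennreal \<bar>f y - fn n y\<bar>) \<in> borel_measurable (stateM Y)" for n by measurable
    show "ennreal \<bar>f y - fn n y\<bar> \<le> ennreal C" if "y \<in> Y" for n y using C[OF that] by (rule ennreal_leI)
    show "(\<lambda>n. ennreal \<bar>f y - fn n y\<bar>) \<longlonglongrightarrow> 0" if "y \<in> Y" for y
    proof -
      have "(\<lambda>n. ennreal \<bar>f y - fn n y\<bar>) \<longlonglongrightarrow> ennreal \<bar>f y - f y\<bar>"
        using lim[OF that] by (intro tendsto_ennrealI tendsto_intros)
      then show ?thesis by simp
    qed
  qed (use e2 in simp)
  then obtain n where n: "\<And>\<eta>. \<eta> \<in> D \<Longrightarrow> (\<integral>\<^sup>+w. ennreal \<bar>f (fst w) - fn n (fst w)\<bar> \<partial>\<eta>) < ennreal (e / 2)" by blast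
  from approxD[OF fn[of n] e2] obtain \<phi> where \<phi>: "continuous_on Y \<phi>" "bounded (\<phi> ` Y)"
    "\<And>\<eta>. \<eta> \<in> D \<Longrightarrow> (\<integral>\<^sup>+w. ennreal \<bar>fn n (fst w) - \<phi> (fst w)\<bar> \<partial>\<eta>) \<le> ennreal (e / 2)" by blast
  note [measurable] = continuous_on_measurable_stateM[OF \<phi>(1)]
  have "(\<integral>\<^sup>+w. ennreal \<bar>f (fst w) - \<phi> (fst w)\<bar> \<partial>\<eta>) \<le> ennreal e" if \<eta>: "\<eta> \<in> D" for \<eta>
  proof -
    have m1: "(\<lambda>y. f y - fn n y) \<in> borel_measurable (stateM Y)"
      and m2: "(\<lambda>y. fn n y - \<phi> y) \<in> borel_measurable (stateM Y)" by measurable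
    have "(\<integral>\<^sup>+w. ennreal \<bar>f (fst w) - \<phi> (fst w)\<bar> \<partial>\<eta>) \<le>
       (\<integral>\<^sup>+w. ennreal \<bar>f (fst w) - fn n (fst w)\<bar> \<partial>\<eta>) + (\<integral>\<^sup>+w. ennreal \<bar>fn n (fst w) - \<phi> (fst w)\<bar> \<partial>\<eta>)"
      by (rule nn_integral_triangle_D[OF \<eta>, of "\<lambda>y. f y - fn n y" "\<lambda>y. fn n y - \<phi> y" "\<lambda>y. f y - \<phi> y", OF m1 m2])
        linarith
    also have "\<dots> \<le> ennreal (e / 2) + ennreal (e / 2)"
      using n[OF \<eta>] \<phi>(3)[OF \<eta>] by (intro add_mono) auto
    also have "\<dots> = ennreal e" using e2 by (simp add: ennreal_plus[symmetric] del: ennreal_plus)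
    finally show ?thesis .
  qed
  then show "\<exists>\<phi>. continuous_on Y \<phi> \<and> bounded (\<phi> ` Y) \<and>
     (\<forall>\<eta>\<in>D. (\<integral>\<^sup>+w. ennreal \<bar>f (fst w) - \<phi> (fst w)\<bar> \<partial>\<eta>) \<le> ennreal e)"
    using \<phi> by blast
qed

lemma indicator_measurable_stateM:
  "B \<in> sets borel \<Longrightarrow> (indicator B :: _ \<Rightarrow> real) \<in> borel_measurable (stateM Y)"
  unfolding stateM_def by (intro measurable_restrict_space1) simp

text \<open>The indicator is the pointwise limit of Lipschitz functions of the distance to
  \<open>C\<close>; closedness makes the distance positive off \<open>C\<close>.\<close>

lemma approx_indicator_closed:
  assumes "closed C"
  shows "approx (indicator C)"
\<comment> \<open>\<open>infdist y {}\<close> is 0 by convention, so for empty \<open>C\<close> the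
  functions below would be constantly 1 rather than tend to 0.\<close>
proof (cases "C = {}")
  case True
  show ?thesis by (rule approx_cong[OF approx_const[of 0]]) (simp add: True)
next
  case False
  define f where "f n y = max 0 (1 - real n * infdist y C)" for n y
  have f01: "0 \<le> f n y" "f n y \<le> 1" for n y
    using infdist_nonneg[of y C] by (auto simp: f_def)
  show ?thesis
  proof (rule approx_limit[of f _ 1])
    show "approx (f n)" for n
    proof (rule approx_continuous)
      show "continuous_on Y (f n)" unfolding f_def by (intro continuous_intros)
      show "bounded (f n ` Y)" using f01 by (intro boundedI[of _ 1]) auto
    qed
    show "(indicator C :: 'x \<Rightarrow> real) \<in> borel_measurable (stateM Y)"
      using assms by (intro indicator_measurable_stateM) auto
    show "\<bar>indicator C y - f n y\<bar> \<le> 1" for n y using f01[of n y] by (auto split: split_indicator)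
    show "(\<lambda>n. f n y) \<longlonglongrightarrow> indicator C y" for y
    proof (cases "y \<in> C")
      case True
      then show ?thesis by (simp add: f_def)
    next
      case False
      then have d: "0 < infdist y C"
        using in_closed_iff_infdist_zero[OF assms \<open>C \<noteq> {}\<close>, of y] infdist_nonneg[of y C] by linarith
      obtain N where N: "1 / infdist y C < real N" using reals_Archimedean2 by blast
      have "f n y = 0" if "n \<ge> N" for n
      proof -
        have "1 / infdist y C \<le> real n" using N that by linarith
        then have "1 \<le> real n * infdist y C" using d by (simp add: divide_le_eq)
        then show ?thesis by (simp add: f_def)
      qed
      then have "\<forall>\<^sub>F n in sequentially. f n y = 0" by (auto simp: eventually_sequentially)
      then show ?thesis using False by (simp add: tendsto_eventually)
    qed
  qed
qed

text \<open>A pi-lambda argument: closed sets form an intersection-stable generator, complements and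
  finite disjoint unions follow by linearity, and countable disjoint unions are limits of finite
  ones.\<close>

lemma approx_indicator:
  assumes "B \<in> sets borel"
  shows "approx (indicator B)"
proof -
  have B: "B \<in> sigma_sets UNIV (Collect closed)"
    using assms by (simp add: borel_eq_closed)
  have meas: "S \<in> sigma_sets UNIV (Collect closed) \<Longrightarrow> S \<in> sets borel" for S :: "'x set"
    by (simp add: borel_eq_closed)
  have stable: "Int_stable (Collect closed :: 'x set set)" by (auto simp: Int_stable_def)
  have "Collect closed \<subseteq> Pow (UNIV :: 'x set)" by simp
  with stable show ?thesis
    using B
  proof (induction rule: sigma_sets_induct_disjoint)
    case (basic S)
    then show ?case by (simp add: approx_indicator_closed)
  next
    case empty
    show ?case by (rule approx_cong[OF approx_const[of 0]]) simp
  next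
    case (compl S)
    have "approx (\<lambda>y. 1 + (-1) * indicator S y)"
      by (intro approx_add approx_const approx_cmult compl)
    then show ?case by (rule approx_cong) (auto split: split_indicator)
  next
    case (union S)
    have part: "approx (indicator (\<Union>i<n. S i))" for n :: nat
    proof (induction n)
      case 0
      show ?case by (rule approx_cong[OF approx_const[of 0]]) simp
    next
      case (Suc n)
      have "approx (\<lambda>y. indicator (\<Union>i<n. S i) y + indicator (S n) y)"
        by (intro approx_add Suc union)
      moreover have "(\<Union>i<n. S i) \<inter> S n = {}"
        using union(1) by (auto simp: disjoint_family_on_def dest: less_imp_neq)
      ultimately show ?case
        by (elim approx_cong) (auto simp: lessThan_Suc split: split_indicator)
    qed
    have "(\<Union>i. S i) \<in> sets borel" using union(2) meas by blast
    then have m: "(indicator (\<Union>i. S i) :: 'x \<Rightarrow> real) \<in> borel_measurable (stateM Y)"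
      by (rule indicator_measurable_stateM)
    show ?case
    proof (rule approx_limit[OF part m])
      show "\<bar>indicator (\<Union>i. S i) y - indicator (\<Union>i<n. S i) y\<bar> \<le> (1::real)" for n y
        by (auto split: split_indicator)
      show "(\<lambda>n. indicator (\<Union>i<n. S i) y :: real) \<longlonglongrightarrow> indicator (\<Union>i. S i) y" for y
        by (rule LIMSEQ_indicator_UN)
    qed
  qed
qed

text \<open>Boundedness stands inside the conclusion so that it passes through the induction on
  measurable functions. It descends from a sum to the summands, and from the limit to the members of
  an increasing sequence, because all functions involved are nonnegative.\<close>

lemma approx_bounded_nonneg:
  assumes "f \<in> borel_measurable (stateM Y)" "\<And>y. 0 \<le> f y"
  shows "bounded (f ` Y) \<longrightarrow> approx f"
  using assms
proof (induction rule: borel_measurable_induct_real)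
  case (set B)
  then have "B \<in> sets borel"
    using Y_borel by (auto simp: stateM_def sets_restrict_space)
  then show ?case by (simp add: approx_indicator)
next
  case (mult u c)
  show ?case
  \<comment> \<open>For \<open>c = 0\<close> boundedness of the product says nothing about
    \<open>u\<close>, so the induction hypothesis cannot be invoked.\<close>
  proof (cases "c = 0")
    case True
    then show ?thesis using approx_const[of 0] by simp
  next
    case False
    show ?thesis
    proof
      assume "bounded ((\<lambda>y. c * u y) ` Y)"
      from bounded_scaling[OF this, of "1 / c"] have "bounded (u ` Y)"
        using False by (simp add: image_image)
      then show "approx (\<lambda>y. c * u y)" using \<open>bounded (u ` Y) \<longrightarrow> approx u\<close> by (intro approx_cmult) auto
    qed
  qed
next
  case (add u v)
  show ?case
  proof
    assume "bounded ((\<lambda>y. v y + u y) ` Y)"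
    then obtain C where C: "\<And>y. y \<in> Y \<Longrightarrow> \<bar>v y + u y\<bar> \<le> C" by (auto simp: bounded_iff)
    have "\<bar>u y\<bar> \<le> C" "\<bar>v y\<bar> \<le> C" if "y \<in> Y" for y
      using C[OF that] \<open>\<And>x. 0 \<le> u x\<close>[of y] \<open>\<And>x. 0 \<le> v x\<close>[of y] by auto
    then have "bounded (u ` Y)" "bounded (v ` Y)" by (auto simp: bounded_iff)
    then show "approx (\<lambda>y. v y + u y)" using add by (intro approx_add) auto
  qed
next
  case (seq U)
  have le: "U i y \<le> f y" if "y \<in> Y" for i y
    using incseq_le[OF _ \<open>\<And>x. x \<in> space (stateM Y) \<Longrightarrow> (\<lambda>i. U i x) \<longlonglongrightarrow> f x\<close>, of y i] \<open>incseq U\<close> that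
    by (auto simp: incseq_def le_fun_def stateM_def space_restrict_space)
  show ?case
  proof
    assume "bounded (f ` Y)"
    then obtain C where C: "\<And>y. y \<in> Y \<Longrightarrow> \<bar>f y\<bar> \<le> C" by (auto simp: bounded_iff)
    have "\<bar>U i y\<bar> \<le> C" if "y \<in> Y" for i y
      using C[OF that] le[OF that, of i] \<open>\<And>i x. 0 \<le> U i x\<close>[of i y] by auto
    then have "bounded (U i ` Y)" for i by (auto simp: bounded_iff)
    then have "approx (U i)" for i using \<open>\<And>i. bounded (U i ` Y) \<longrightarrow> approx (U i)\<close> by auto
    then show "approx f"
    proof (rule approx_limit[of _ _ C])
      show "f \<in> borel_measurable (stateM Y)" by fact
      show "\<bar>f y - U i y\<bar> \<le> C" if "y \<in> Y" for i y
        using C[OF that] le[OF that, of i] \<open>\<And>i x. 0 \<le> U i x\<close>[of i y] by auto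
      show "(\<lambda>i. U i y) \<longlonglongrightarrow> f y" if "y \<in> Y" for y
        using \<open>\<And>x. x \<in> space (stateM Y) \<Longrightarrow> (\<lambda>i. U i x) \<longlonglongrightarrow> f x\<close> that by (simp add: stateM_def space_restrict_space)
    qed
  qed
qed

lemma approx_bounded:
  assumes [measurable]: "f \<in> borel_measurable (stateM Y)" and C: "\<And>y. y \<in> Y \<Longrightarrow> \<bar>f y\<bar> \<le> C"
  shows "approx f"
proof -
  \<comment> \<open>The shift by \<open>C\<close> makes \<open>f\<close> nonnegative on
    \<open>Y\<close>; the truncation does so off \<open>Y\<close>, where \<open>f\<close> is not
    controlled, because \<open>approx_bounded_nonneg\<close> asks for the sign on the whole
    type.\<close>
  define u where "u y = max 0 (f y + C)" for y
  have "bounded (u ` Y)"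
    by (rule boundedI[of _ "2 * C"]) (use C in \<open>force simp: u_def\<close>)
  moreover have "u \<in> borel_measurable (stateM Y)" unfolding u_def by measurable
  ultimately have "approx u"
    using approx_bounded_nonneg[of u] by (simp add: u_def)
  then have "approx (\<lambda>y. u y + (- C))"
    by (intro approx_add approx_const)
  then show ?thesis by (rule approx_cong) (use C in \<open>force simp: u_def\<close>)
qed

text \<open>A partition of unity on \<open>A\<close> of mesh \<open>1/(n+1)\<close> turns \<open>g\<close> into a finite sum of products of a
  measurable function of the state and a continuous function of the action; the error at a state is the
  modulus of continuity of \<open>g\<close> there, so it vanishes as \<open>n\<close> grows.\<close>
lemma approx_caratheodory:
  assumes g: "g \<in> bcarath_funs Y A" and e: "0 < e"
  shows "\<exists>\<phi>\<in>bcont_funs Y A. \<forall>\<eta>\<in>D. (\<integral>\<^sup>+w. ennreal \<bar>g w - \<phi> w\<bar> \<partial>\<eta>) \<le> ennreal e"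
proof -
  have g_meas: "g \<in> borel_measurable (stateM Y \<Otimes>\<^sub>M stateM A)"
    and g_cont: "\<And>y. y \<in> Y \<Longrightarrow> continuous_on A (\<lambda>a. g (y, a))"
    using g by (auto simp: bcarath_funs_def)
  obtain M where M: "\<And>y a. y \<in> Y \<Longrightarrow> a \<in> A \<Longrightarrow> \<bar>g (y, a)\<bar> \<le> M"
    using g by (auto simp: bcarath_funs_def bounded_iff)
  have g_sec: "(\<lambda>y. g (y, a)) \<in> borel_measurable (stateM Y)" if "a \<in> A" for a
    using that by (intro measurable_compose[OF _ g_meas] measurable_Pair)
      (auto simp: stateM_def space_restrict_space)
  have "\<forall>n. \<exists>K \<psi>. finite K \<and> K \<subseteq> A \<and> (\<forall>k. continuous_on A (\<psi> k)) \<and> (\<forall>k a. 0 \<le> (\<psi> k a :: real)) \<and>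
    (\<forall>a\<in>A. (\<Sum>k\<in>K. \<psi> k a) = 1) \<and> (\<forall>k a. \<psi> k a \<noteq> 0 \<longrightarrow> dist k a < 1 / (real n + 1))"
  proof
    fix n :: nat
    have "0 < 1 / (real n + 1)" by simp
    from compact_partition_of_unity[OF compact_A this] obtain K and \<psi> :: "'a \<Rightarrow> 'a \<Rightarrow> real"
      where "finite K" "K \<subseteq> A" "\<And>k. continuous_on A (\<psi> k)"
        "\<And>k a. 0 \<le> \<psi> k a" "\<And>a. a \<in> A \<Longrightarrow> (\<Sum>k\<in>K. \<psi> k a) = 1" "\<And>k a. \<psi> k a \<noteq> 0 \<Longrightarrow> dist k a < 1 / (real n + 1)"
      by metis
    then show "\<exists>K \<psi>. finite K \<and> K \<subseteq> A \<and> (\<forall>k. continuous_on A (\<psi> k)) \<and> (\<forall>k a. 0 \<le> (\<psi> k a :: real)) \<and>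
      (\<forall>a\<in>A. (\<Sum>k\<in>K. \<psi> k a) = 1) \<and> (\<forall>k a. \<psi> k a \<noteq> 0 \<longrightarrow> dist k a < 1 / (real n + 1))"
      by (intro exI[of _ K] exI[of _ \<psi>]) simp
  qed
  then obtain K and \<psi> :: "nat \<Rightarrow> 'a \<Rightarrow> 'a \<Rightarrow> real" where K: "\<And>n. finite (K n)" "\<And>n. K n \<subseteq> A"
    and \<psi>_cont: "\<And>n k. continuous_on A (\<psi> n k)" and \<psi>_nonneg: "\<And>n k a. 0 \<le> \<psi> n k a"
    and \<psi>_sum: "\<And>n a. a \<in> A \<Longrightarrow> (\<Sum>k\<in>K n. \<psi> n k a) = 1"
    and \<psi>_supp: "\<And>n k a. \<psi> n k a \<noteq> 0 \<Longrightarrow> dist k a < 1 / (real n + 1)"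
    by metis
  define gn where "gn n y a = (\<Sum>k\<in>K n. g (y, k) * \<psi> n k a)" for n y a
  \<comment> \<open>The weights sum to 1, so the error is a weighted average of
    \<open>g (y, a) - g (y, k)\<close> over the net points near \<open>a\<close>. It is applied
    twice: with the crude bound \<open>2 * M\<close> for domination and with the modulus of
    continuity for convergence.\<close>
  have diff: "\<bar>g (y, a) - gn n y a\<bar> \<le> d"
    if a: "a \<in> A" and d: "\<And>k. k \<in> K n \<Longrightarrow> \<psi> n k a \<noteq> 0 \<Longrightarrow> \<bar>g (y, a) - g (y, k)\<bar> \<le> d" for n y a d
  proof -
    have "g (y, a) - gn n y a = (\<Sum>k\<in>K n. (g (y, a) - g (y, k)) * \<psi> n k a)"
      by (simp add: gn_def left_diff_distrib sum_subtractf sum_distrib_left[symmetric] \<psi>_sum[OF a])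
    also have "\<bar>\<dots>\<bar> \<le> (\<Sum>k\<in>K n. \<bar>(g (y, a) - g (y, k)) * \<psi> n k a\<bar>)" by (rule sum_abs)
    also have "\<dots> \<le> (\<Sum>k\<in>K n. d * \<psi> n k a)"
    proof (rule sum_mono)
      fix k assume k: "k \<in> K n"
      show "\<bar>(g (y, a) - g (y, k)) * \<psi> n k a\<bar> \<le> d * \<psi> n k a"
      proof (cases "\<psi> n k a = 0")
        case False
        then show ?thesis
          using d[OF k False] \<psi>_nonneg[of n k a] by (simp add: abs_mult mult_right_mono)
      qed simp
    qed
    also have "\<dots> = d" by (simp add: sum_distrib_left[symmetric] \<psi>_sum[OF a])
    finally show ?thesis .
  qed
  \<comment> \<open>A supremum over countably many actions stays measurable in the state. By
    continuity in the action it still dominates the error at every action of \<open>A\<close>, which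
    is \<open>le_m\<close> below.\<close>
  obtain A0 where A0: "countable A0" "A0 \<subseteq> A" "A \<subseteq> closure A0" by (rule separable[of A])
  define m where "m n y = (SUP a\<in>A0. ennreal \<bar>g (y, a) - gn n y a\<bar>)" for n y
  have gn_meas: "(\<lambda>y. gn n y a) \<in> borel_measurable (stateM Y)" for n a
    unfolding gn_def using K(2)[of n] g_sec
    by (intro borel_measurable_sum borel_measurable_times borel_measurable_const) auto
  have m_meas: "m n \<in> borel_measurable (stateM Y)" for n
    unfolding m_def[abs_def]
  proof (rule borel_measurable_SUP[OF A0(1)])
    fix a assume "a \<in> A0"
    then have [measurable]: "(\<lambda>y. g (y, a)) \<in> borel_measurable (stateM Y)" using A0 g_sec by auto
    note [measurable] = gn_meas[of n a]
    show "(\<lambda>y. ennreal \<bar>g (y, a) - gn n y a\<bar>) \<in> borel_measurable (stateM Y)" by measurable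
  qed
  have m_le: "m n y \<le> ennreal (2 * M)" if y: "y \<in> Y" for n y
    unfolding m_def
  proof (intro SUP_least ennreal_leI diff)
    fix a k assume "a \<in> A0" then show "a \<in> A" using A0 by auto
    moreover assume "k \<in> K n"
    ultimately show "\<bar>g (y, a) - g (y, k)\<bar> \<le> 2 * M"
      using M[OF y, of a] M[OF y, of k] K(2)[of n] by fastforce
  qed
  \<comment> \<open>For fixed \<open>y\<close>, continuity in the action is uniform on the compact
    set \<open>A\<close>. The rate may depend on \<open>y\<close>; \<open>vanish_dominated\<close>
    turns this pointwise convergence into smallness uniform over \<open>D\<close>.\<close>
  have m_lim: "(\<lambda>n. m n y) \<longlonglongrightarrow> 0" if y: "y \<in> Y" for y
  proof (rule order_tendstoI)
    fix d :: ennreal assume "0 < d"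
    then obtain d' where d': "0 < d'" "d' < d" using dense by blast
    obtain r where r: "d' = ennreal r" "0 < r"
      using d' by (cases d') (auto simp: top_unique)
    have "uniformly_continuous_on A (\<lambda>a. g (y, a))"
      by (rule compact_uniformly_continuous[OF g_cont[OF y] compact_A])
    then obtain \<delta> where \<delta>: "0 < \<delta>"
      "\<And>a b. a \<in> A \<Longrightarrow> b \<in> A \<Longrightarrow> dist b a < \<delta> \<Longrightarrow> dist (g (y, b)) (g (y, a)) < r"
      unfolding uniformly_continuous_on_def using r(2) by meson
    obtain N where N: "inverse (real (Suc N)) < \<delta>" using reals_Archimedean[OF \<delta>(1)] by blast
    have "m n y < d" if n: "n \<ge> N" for n
    proof -
      have "1 / (real n + 1) \<le> 1 / (real N + 1)" using n by (simp add: frac_le)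
      then have small: "1 / (real n + 1) < \<delta>" using N by (simp add: inverse_eq_divide add.commute)
      have "m n y \<le> ennreal r"
        unfolding m_def
      proof (intro SUP_least ennreal_leI diff)
        fix a k assume "a \<in> A0" then show a: "a \<in> A" using A0 by auto
        assume k: "k \<in> K n" "\<psi> n k a \<noteq> 0"
        then have "dist a k < \<delta>" using \<psi>_supp[OF k(2)] small by (simp add: dist_commute)
        moreover have "k \<in> A" using k K(2) by auto
        ultimately show "\<bar>g (y, a) - g (y, k)\<bar> \<le> r"
          using \<delta>(2)[of k a] a by (simp add: dist_real_def)
      qed
      then show ?thesis using d' r by simp
    qed
    then show "\<forall>\<^sub>F n in sequentially. m n y < d" by (auto simp: eventually_sequentially)
  qed auto
  have le_m: "ennreal \<bar>g (y, a) - gn n y a\<bar> \<le> m n y" if y: "y \<in> Y" and a: "a \<in> A" for n y a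
  proof -
    have "a \<in> closure A0" using a A0 by auto
    then obtain b where b: "\<And>i. b i \<in> A0" "b \<longlonglongrightarrow> a" unfolding closure_sequential by blast
    have "continuous_on A (\<lambda>a. \<bar>g (y, a) - gn n y a\<bar>)"
      unfolding gn_def by (intro continuous_intros g_cont[OF y] \<psi>_cont)
    from continuous_on_tendsto_compose[OF this b(2) a]
    have "(\<lambda>i. \<bar>g (y, b i) - gn n y (b i)\<bar>) \<longlonglongrightarrow> \<bar>g (y, a) - gn n y a\<bar>"
      using b(1) A0(2) by (auto simp: subset_iff)
    then have "(\<lambda>i. ennreal \<bar>g (y, b i) - gn n y (b i)\<bar>) \<longlonglongrightarrow> ennreal \<bar>g (y, a) - gn n y a\<bar>"
      by (rule tendsto_ennrealI)
    then show ?thesis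
      by (rule LIMSEQ_le_const2) (auto simp: m_def intro!: SUP_upper b)
  qed
  have "0 < ennreal (e / 2)" using e by simp
  from vanish_dominated[OF m_meas m_le m_lim this]
  obtain n where n: "\<And>\<eta>. \<eta> \<in> D \<Longrightarrow> (\<integral>\<^sup>+w. m n (fst w) \<partial>\<eta>) < ennreal (e / 2)" by blast
  \<comment> \<open>Shares the second half of \<open>e\<close> among the net points; adding 1 covers
    an empty net.\<close>
  define c where "c = e / (2 * (real (card (K n)) + 1))"
  have c: "0 < c" "real (card (K n)) * c \<le> e / 2" using e by (auto simp: c_def field_simps)
  have "\<forall>k\<in>K n. \<exists>\<phi>. continuous_on Y \<phi> \<and> bounded (\<phi> ` Y) \<and>
     (\<forall>\<eta>\<in>D. (\<integral>\<^sup>+w. ennreal \<bar>g (fst w, k) - \<phi> (fst w)\<bar> \<partial>\<eta>) \<le> ennreal c)"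
  proof
    fix k assume "k \<in> K n"
    then have k: "k \<in> A" using K(2) by auto
    have "approx (\<lambda>y. g (y, k))" using M k by (intro approx_bounded[OF g_sec[OF k]])
    then show "\<exists>\<phi>. continuous_on Y \<phi> \<and> bounded (\<phi> ` Y) \<and>
       (\<forall>\<eta>\<in>D. (\<integral>\<^sup>+w. ennreal \<bar>g (fst w, k) - \<phi> (fst w)\<bar> \<partial>\<eta>) \<le> ennreal c)"
      using c(1) unfolding approx_def by blast
  qed
  from bchoice[OF this] obtain \<phi> where \<phi>: "\<forall>k\<in>K n. continuous_on Y (\<phi> k) \<and> bounded (\<phi> k ` Y) \<and>
     (\<forall>\<eta>\<in>D. (\<integral>\<^sup>+w. ennreal \<bar>g (fst w, k) - \<phi> k (fst w)\<bar> \<partial>\<eta>) \<le> ennreal c)" ..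
  then have \<phi>_cont: "\<And>k. k \<in> K n \<Longrightarrow> continuous_on Y (\<phi> k)"
    and \<phi>_bdd: "\<And>k. k \<in> K n \<Longrightarrow> bounded (\<phi> k ` Y)"
    and \<phi>_int: "\<And>k \<eta>. k \<in> K n \<Longrightarrow> \<eta> \<in> D \<Longrightarrow> (\<integral>\<^sup>+w. ennreal \<bar>g (fst w, k) - \<phi> k (fst w)\<bar> \<partial>\<eta>) \<le> ennreal c"
    by auto
  have \<psi>_le1: "\<psi> n k a \<le> 1" if "k \<in> K n" "a \<in> A" for k a
    using member_le_sum[of k "K n" "\<lambda>k. \<psi> n k a"] that K(1) \<psi>_nonneg \<psi>_sum[OF that(2)] by auto
  \<comment> \<open>\<open>gn n\<close> with each coefficient \<open>g (y, k)\<close> replaced by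
    its continuous approximation, which makes it jointly continuous. As the weights are at most 1,
    the distance to \<open>g\<close> is at most the modulus \<open>m n\<close> plus the sum of the
    coefficient errors.\<close>
  define \<Phi> where "\<Phi> w = (\<Sum>k\<in>K n. \<phi> k (fst w) * \<psi> n k (snd w))" for w
  have "\<Phi> \<in> bcont_funs Y A"
    unfolding bcont_funs_def
  proof (intro CollectI conjI)
    show "continuous_on (Y \<times> A) \<Phi>"
      unfolding \<Phi>_def
    proof (intro continuous_on_sum continuous_on_mult)
      fix k assume k: "k \<in> K n"
      show "continuous_on (Y \<times> A) (\<lambda>w. \<phi> k (fst w))"
        by (rule continuous_on_compose2[OF \<phi>_cont[OF k] continuous_on_fst[OF continuous_on_id]]) auto
      show "continuous_on (Y \<times> A) (\<lambda>w. \<psi> n k (snd w))"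
        by (rule continuous_on_compose2[OF \<psi>_cont continuous_on_snd[OF continuous_on_id]]) auto
    qed
    have "\<forall>k\<in>K n. \<exists>B. \<forall>y\<in>Y. \<bar>\<phi> k y\<bar> \<le> B" using \<phi>_bdd by (simp add: bounded_iff)
    then obtain B where B: "\<And>k y. k \<in> K n \<Longrightarrow> y \<in> Y \<Longrightarrow> \<bar>\<phi> k y\<bar> \<le> B k" by metis
    have "\<bar>\<Phi> w\<bar> \<le> (\<Sum>k\<in>K n. B k)" if "w \<in> Y \<times> A" for w
      unfolding \<Phi>_def
    proof (rule order_trans[OF sum_abs sum_mono])
      fix k assume k: "k \<in> K n"
      have w: "fst w \<in> Y" "snd w \<in> A" using that by auto
      have "\<bar>\<phi> k (fst w)\<bar> * \<psi> n k (snd w) \<le> \<bar>\<phi> k (fst w)\<bar> * 1"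
        using \<psi>_le1[OF k w(2)] by (intro mult_left_mono) auto
      then show "\<bar>\<phi> k (fst w) * \<psi> n k (snd w)\<bar> \<le> B k"
        using B[OF k w(1)] \<psi>_nonneg[of n k "snd w"] by (simp add: abs_mult)
    qed
    then show "bounded (\<Phi> ` (Y \<times> A))" by (intro boundedI[of _ "\<Sum>k\<in>K n. B k"]) auto
  qed
  moreover have "(\<integral>\<^sup>+w. ennreal \<bar>g w - \<Phi> w\<bar> \<partial>\<eta>) \<le> ennreal e" if \<eta>: "\<eta> \<in> D" for \<eta>
  proof -
    have meas: "(\<lambda>w. ennreal \<bar>g (fst w, k) - \<phi> k (fst w)\<bar>) \<in> borel_measurable \<eta>" if k: "k \<in> K n" for k
    proof (rule fst_measurable_D[OF \<eta>, of "\<lambda>y. ennreal \<bar>g (y, k) - \<phi> k y\<bar>"])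
      have [measurable]: "(\<lambda>y. g (y, k)) \<in> borel_measurable (stateM Y)" using k K(2) g_sec by auto
      note [measurable] = continuous_on_measurable_stateM[OF \<phi>_cont[OF k]]
      show "(\<lambda>y. ennreal \<bar>g (y, k) - \<phi> k y\<bar>) \<in> borel_measurable (stateM Y)" by measurable
    qed
    have "(\<integral>\<^sup>+w. ennreal \<bar>g w - \<Phi> w\<bar> \<partial>\<eta>) \<le>
      (\<integral>\<^sup>+w. m n (fst w) + (\<Sum>k\<in>K n. ennreal \<bar>g (fst w, k) - \<phi> k (fst w)\<bar>) \<partial>\<eta>)"
    proof (rule nn_integral_mono)
      fix w assume "w \<in> space \<eta>"
      then obtain y a where w: "w = (y, a)" and y: "y \<in> Y" and a: "a \<in> A"
        using space_D[OF \<eta>] by auto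
      have "\<bar>gn n y a - \<Phi> w\<bar> = \<bar>\<Sum>k\<in>K n. (g (y, k) - \<phi> k y) * \<psi> n k a\<bar>"
        by (simp add: gn_def \<Phi>_def w sum_subtractf left_diff_distrib)
      also have "\<dots> \<le> (\<Sum>k\<in>K n. \<bar>g (y, k) - \<phi> k y\<bar>)"
      proof (rule order_trans[OF sum_abs sum_mono])
        fix k assume k: "k \<in> K n"
        have "\<bar>g (y, k) - \<phi> k y\<bar> * \<psi> n k a \<le> \<bar>g (y, k) - \<phi> k y\<bar> * 1"
          using \<psi>_le1[OF k a] by (intro mult_left_mono) auto
        then show "\<bar>(g (y, k) - \<phi> k y) * \<psi> n k a\<bar> \<le> \<bar>g (y, k) - \<phi> k y\<bar>"
          using \<psi>_nonneg[of n k a] by (simp add: abs_mult)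
      qed
      finally have "\<bar>g w - \<Phi> w\<bar> \<le> \<bar>g (y, a) - gn n y a\<bar> + (\<Sum>k\<in>K n. \<bar>g (y, k) - \<phi> k y\<bar>)"
        unfolding w by linarith
      then have "ennreal \<bar>g w - \<Phi> w\<bar> \<le> ennreal (\<bar>g (y, a) - gn n y a\<bar> + (\<Sum>k\<in>K n. \<bar>g (y, k) - \<phi> k y\<bar>))"
        by (rule ennreal_leI)
      also have "\<dots> = ennreal \<bar>g (y, a) - gn n y a\<bar> + (\<Sum>k\<in>K n. ennreal \<bar>g (y, k) - \<phi> k y\<bar>)"
        by (simp add: sum_nonneg sum_ennreal)
      also have "\<dots> \<le> m n y + (\<Sum>k\<in>K n. ennreal \<bar>g (y, k) - \<phi> k y\<bar>)"
        using le_m[OF y a] by (rule add_right_mono)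
      finally show "ennreal \<bar>g w - \<Phi> w\<bar> \<le> m n (fst w) + (\<Sum>k\<in>K n. ennreal \<bar>g (fst w, k) - \<phi> k (fst w)\<bar>)"
        by (simp add: w)
    qed
    also have "\<dots> = (\<integral>\<^sup>+w. m n (fst w) \<partial>\<eta>) + (\<integral>\<^sup>+w. (\<Sum>k\<in>K n. ennreal \<bar>g (fst w, k) - \<phi> k (fst w)\<bar>) \<partial>\<eta>)"
      using fst_measurable_D[OF \<eta> m_meas] meas by (intro nn_integral_add borel_measurable_sum)
    also have "(\<integral>\<^sup>+w. (\<Sum>k\<in>K n. ennreal \<bar>g (fst w, k) - \<phi> k (fst w)\<bar>) \<partial>\<eta>) =
       (\<Sum>k\<in>K n. \<integral>\<^sup>+w. ennreal \<bar>g (fst w, k) - \<phi> k (fst w)\<bar> \<partial>\<eta>)"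
      using meas by (rule nn_integral_sum)
    also have "(\<integral>\<^sup>+w. m n (fst w) \<partial>\<eta>) + \<dots> \<le> ennreal (e / 2) + (\<Sum>k\<in>K n. ennreal c)"
      using n[OF \<eta>] \<phi>_int[OF _ \<eta>] by (intro add_mono sum_mono) auto
    also have "(\<Sum>k\<in>K n. ennreal c) = ennreal (real (card (K n)) * c)"
      using c(1) by (simp add: ennreal_mult ennreal_of_nat_eq_real_of_nat)
    also have "ennreal (e / 2) + \<dots> \<le> ennreal (e / 2) + ennreal (e / 2)"
      using c(2) by (intro add_left_mono ennreal_leI)
    also have "\<dots> = ennreal e" using e by (simp add: ennreal_plus[symmetric] del: ennreal_plus)
    finally show ?thesis .
  qed
  ultimately show ?thesis by blast
qed

section \<open>Comparison of the two topologies\<close>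

lemma integrable_bcarath:
  assumes g: "g \<in> bcarath_funs Y A" and \<eta>: "\<eta> \<in> finite_measures Y A"
  shows "integrable \<eta> g"
proof -
  have sets: "sets \<eta> = sets (stateM Y \<Otimes>\<^sub>M stateM A)" and fin: "finite_measure \<eta>"
    using \<eta> by (auto simp: finite_measures_def)
  interpret finite_measure \<eta> by (rule fin)
  have sp: "space \<eta> = Y \<times> A"
    using sets_eq_imp_space_eq[OF sets] by (simp add: space_pair_measure stateM_def space_restrict_space)
  obtain M where M: "\<And>w. w \<in> Y \<times> A \<Longrightarrow> \<bar>g w\<bar> \<le> M"
    using g by (auto simp: bcarath_funs_def bounded_iff)
  have "g \<in> borel_measurable \<eta>"
    using g measurable_cong_sets[OF sets refl] by (auto simp: bcarath_funs_def)
  then show ?thesis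
    using M sp by (intro integrable_const_bound[where B=M]) auto
qed

lemma integral_uniformly_approximated:
  assumes g: "g \<in> bcarath_funs Y A" and e: "0 < e"
  obtains \<phi> where "\<phi> \<in> bcont_funs Y A"
    "\<And>\<eta>. \<eta> \<in> D \<Longrightarrow> \<eta> \<in> finite_measures Y A \<Longrightarrow> \<bar>(\<integral>w. g w \<partial>\<eta>) - (\<integral>w. \<phi> w \<partial>\<eta>)\<bar> \<le> e"
proof -
  obtain \<phi> where \<phi>: "\<phi> \<in> bcont_funs Y A" "\<And>\<eta>. \<eta> \<in> D \<Longrightarrow> (\<integral>\<^sup>+w. ennreal \<bar>g w - \<phi> w\<bar> \<partial>\<eta>) \<le> ennreal e"
    using approx_caratheodory[OF g e] by blast
  have "\<bar>(\<integral>w. g w \<partial>\<eta>) - (\<integral>w. \<phi> w \<partial>\<eta>)\<bar> \<le> e" if \<eta>: "\<eta> \<in> D" "\<eta> \<in> finite_measures Y A" for \<eta>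
  proof -
    have ig: "integrable \<eta> g" using g \<eta>(2) by (rule integrable_bcarath)
    have i\<phi>: "integrable \<eta> \<phi>" using \<phi>(1) bcont_subset_bcarath \<eta>(2) by (intro integrable_bcarath) auto
    have "ennreal (norm (\<integral>w. g w - \<phi> w \<partial>\<eta>)) \<le> (\<integral>\<^sup>+w. ennreal (norm (g w - \<phi> w)) \<partial>\<eta>)"
      using ig i\<phi> by (intro integral_norm_bound_ennreal) auto
    also have "\<dots> \<le> ennreal e" using \<phi>(2)[OF \<eta>(1)] by simp
    finally show ?thesis using e ig i\<phi> by simp
  qed
  then show thesis using that \<phi>(1) by blast
qed

lemma w_ws_topologies_agree: "subtopology (w_topology Y A) D = subtopology (ws_topology Y A) D"
proof (rule topology_eq[THEN iffD2], intro allI iffI)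
  fix U assume "openin (subtopology (w_topology Y A) D) U"
  then obtain V where V: "openin (w_topology Y A) V" "U = V \<inter> D" by (auto simp: openin_subtopology)
  have "generate_topology_on {{\<mu> \<in> finite_measures Y A. (\<integral>z. g z \<partial>\<mu>) \<in> U} | g U. g \<in> bcont_funs Y A \<and> open U} V"
    using V(1) unfolding w_topology_def integral_topology_def openin_topology_generated_by_iff .
  then have "openin (ws_topology Y A) V"
  proof (induction rule: generate_topology_on.induct)
    case (Basis s)
    then show ?case
      using bcont_subset_bcarath unfolding ws_topology_def integral_topology_def
      by (intro topology_generated_by_Basis) blast
  qed auto
  then show "openin (subtopology (ws_topology Y A) D) U" using V(2) by (auto simp: openin_subtopology)
next
  fix U assume "openin (subtopology (ws_topology Y A) D) U"
  then obtain V where V: "openin (ws_topology Y A) V" "U = V \<inter> D" by (auto simp: openin_subtopology)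
  have "generate_topology_on {{\<mu> \<in> finite_measures Y A. (\<integral>z. g z \<partial>\<mu>) \<in> U} | g U. g \<in> bcarath_funs Y A \<and> open U} V"
    using V(1) unfolding ws_topology_def integral_topology_def openin_topology_generated_by_iff .
  \<comment> \<open>The induction runs on traces on \<open>D\<close>, because the uniform
    approximation holds only there; traces commute with finite intersections and unions.\<close>
  then have "openin (subtopology (w_topology Y A) D) (V \<inter> D)"
  proof (induction rule: generate_topology_on.induct)
    case (Int a b)
    have "openin (subtopology (w_topology Y A) D) ((a \<inter> D) \<inter> (b \<inter> D))" by (rule openin_Int[OF Int.IH])
    moreover have "(a \<inter> D) \<inter> (b \<inter> D) = a \<inter> b \<inter> D" by auto
    ultimately show ?case by simp
  next
    case (UN K)
    have "openin (subtopology (w_topology Y A) D) (\<Union>k\<in>K. k \<inter> D)"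
      using UN.IH by (intro openin_Union) blast
    moreover have "(\<Union>k\<in>K. k \<inter> D) = \<Union>K \<inter> D" by auto
    ultimately show ?case by simp
  next
    case (Basis s)
    then obtain g W where s: "s = {\<mu> \<in> finite_measures Y A. (\<integral>z. g z \<partial>\<mu>) \<in> W}"
      and g: "g \<in> bcarath_funs Y A" and W: "open W" by blast
    show ?case
    proof (subst openin_subopen, intro ballI)
      fix \<mu> assume "\<mu> \<in> s \<inter> D"
      then have \<mu>: "\<mu> \<in> finite_measures Y A" "(\<integral>z. g z \<partial>\<mu>) \<in> W" "\<mu> \<in> D" by (auto simp: s)
      obtain e where e: "0 < e" "ball (\<integral>z. g z \<partial>\<mu>) e \<subseteq> W"
        using W \<mu>(2) unfolding open_contains_ball by blast
      \<comment> \<open>One third each for replacing \<open>g\<close> by \<open>\<phi>\<close> at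
        \<open>\<mu>\<close>, replacing it at \<open>\<nu>\<close>, and the variation of the
        integral of \<open>\<phi>\<close> between \<open>\<mu>\<close> and
        \<open>\<nu>\<close>.\<close>
      then have "0 < e / 3" by simp
      from integral_uniformly_approximated[OF g this] obtain \<phi> where \<phi>: "\<phi> \<in> bcont_funs Y A"
        "\<And>\<eta>. \<eta> \<in> D \<Longrightarrow> \<eta> \<in> finite_measures Y A \<Longrightarrow> \<bar>(\<integral>w. g w \<partial>\<eta>) - (\<integral>w. \<phi> w \<partial>\<eta>)\<bar> \<le> e / 3" by blast
      define N where "N = {\<nu> \<in> finite_measures Y A. (\<integral>z. \<phi> z \<partial>\<nu>) \<in> ball (\<integral>z. \<phi> z \<partial>\<mu>) (e / 3)}"
      have "openin (w_topology Y A) N"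
        unfolding w_topology_def integral_topology_def N_def
        using \<phi>(1) by (intro topology_generated_by_Basis) blast
      then have "openin (subtopology (w_topology Y A) D) (N \<inter> D)"
        by (auto simp: openin_subtopology)
      moreover have "\<mu> \<in> N \<inter> D" using \<mu> e by (simp add: N_def)
      moreover have "N \<inter> D \<subseteq> s \<inter> D"
      proof
        fix \<nu> assume "\<nu> \<in> N \<inter> D"
        then have \<nu>: "\<nu> \<in> finite_measures Y A" "\<nu> \<in> D" "\<bar>(\<integral>z. \<phi> z \<partial>\<mu>) - (\<integral>z. \<phi> z \<partial>\<nu>)\<bar> < e / 3"
          by (auto simp: N_def dist_real_def)
        have "\<bar>(\<integral>z. g z \<partial>\<mu>) - (\<integral>z. g z \<partial>\<nu>)\<bar> < e"
          using \<phi>(2)[OF \<mu>(3,1)] \<phi>(2)[OF \<nu>(2,1)] \<nu>(3) by linarith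
        then have "(\<integral>z. g z \<partial>\<nu>) \<in> W" using e(2) by (auto simp: dist_real_def)
        then show "\<nu> \<in> s \<inter> D" using \<nu> by (simp add: s)
      qed
      ultimately show "\<exists>T. openin (subtopology (w_topology Y A) D) T \<and> \<mu> \<in> T \<and> T \<subseteq> s \<inter> D" by blast
    qed
  qed auto
  then show "openin (subtopology (w_topology Y A) D) U" using V(2) by simp
qed

end

subsection \<open>Occupation measures of uniformly absorbing models\<close>

text \<open>Used with \<open>D\<close> a countable dense set of actions: countability makes the operator preserve measurability, and Condition (S) makes the supremum agree with the one
  over all actions.\<close>
definition bellman :: "('x \<Rightarrow> 'a \<Rightarrow> 'x measure) \<Rightarrow> 'a set \<Rightarrow> ('x \<Rightarrow> ennreal) \<Rightarrow> 'x \<Rightarrow> ennreal" where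
  "bellman p D f y = (SUP d\<in>D. \<integral>\<^sup>+z. f z \<partial>p y d)"

text \<open>Tonelli for two counting measures. It gives countable additivity of the sum over times
  that defines \<open>occupation\<close>.\<close>

lemma ennreal_suminf_swap:
  fixes f :: "nat \<Rightarrow> nat \<Rightarrow> ennreal"
  shows "(\<Sum>i. \<Sum>n. f i n) = (\<Sum>n. \<Sum>i. f i n)"
proof -
  have "(\<Sum>i. \<Sum>n. f i n) = (\<integral>\<^sup>+i. (\<Sum>n. f i n) \<partial>count_space UNIV)"
    by (simp add: nn_integral_count_space_nat)
  also have "\<dots> = (\<Sum>n. \<integral>\<^sup>+i. f i n \<partial>count_space UNIV)"
    by (rule nn_integral_suminf) simp
  finally show ?thesis by (simp add: nn_integral_count_space_nat)
qed

locale mdp =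
  fixes X Y :: "'x::polish_space set" and \<Delta> :: 'x and A :: "'a::polish_space set"
    and p :: "'x \<Rightarrow> 'a \<Rightarrow> 'x measure"
  assumes X_eq: "X = Y \<union> {\<Delta>}"
    and Y_borel: "Y \<in> sets borel"
    and Delta_notin: "\<Delta> \<notin> Y"
    and p_kernel [measurable]: "(\<lambda>(x, a). p x a) \<in> measurable (stateM X \<Otimes>\<^sub>M stateM A)
                     (prob_algebra (stateM X))"
    and Delta_absorb: "\<forall>a\<in>A. emeasure (p \<Delta> a) {\<Delta>} = 1"
    and S: "condition_S X A p"
begin

section \<open>The transition kernel and the operator \<open>T\<close>\<close>

lemma p_prob:
  assumes "y \<in> X" "a \<in> A"
  shows "p y a \<in> space (prob_algebra (stateM X))"
    "sets (p y a) = sets (stateM X)" "space (p y a) = X" "prob_space (p y a)"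
proof -
  show *: "p y a \<in> space (prob_algebra (stateM X))"
    using measurable_space[OF p_kernel, of "(y, a)"] assms by (simp add: space_pair_measure)
  then show 1: "sets (p y a) = sets (stateM X)" "prob_space (p y a)"
    by (simp_all add: space_prob_algebra)
  show "space (p y a) = X"
    using sets_eq_imp_space_eq[OF 1(1)] by simp
qed

definition actions_dense :: "'a set" where
  "actions_dense = (SOME D. countable D \<and> D \<subseteq> A \<and> A \<subseteq> closure D)"

lemma actions_dense: "countable actions_dense" "actions_dense \<subseteq> A" "A \<subseteq> closure actions_dense"
proof -
  obtain D where "countable D" "D \<subseteq> A" "A \<subseteq> closure D"
    by (rule separable[of A])
  then have "\<exists>D. countable D \<and> D \<subseteq> A \<and> A \<subseteq> closure D" by blast
  from someI_ex[OF this] show "countable actions_dense" "actions_dense \<subseteq> A" "A \<subseteq> closure actions_dense"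
    unfolding actions_dense_def by auto
qed

abbreviation "T \<equiv> bellman p actions_dense"

lemma T_measurable [measurable]:
  assumes [measurable]: "f \<in> borel_measurable (stateM X)"
  shows "T f \<in> borel_measurable (stateM X)"
proof -
  have "(\<lambda>y. \<integral>\<^sup>+z. f z \<partial>p y d) \<in> borel_measurable (stateM X)" if "d \<in> actions_dense" for d
  proof -
    have d: "d \<in> space (stateM A)" using that actions_dense by auto
    have "(\<lambda>y. (\<lambda>(x, a). p x a) (y, d)) \<in> stateM X \<rightarrow>\<^sub>M prob_algebra (stateM X)"
      by (rule measurable_compose[OF _ p_kernel]) (use d in measurable)
    then have "(\<lambda>y. p y d) \<in> stateM X \<rightarrow>\<^sub>M subprob_algebra (stateM X)"
      by (simp add: measurable_prob_algebraD)
    then show ?thesis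
      by (rule measurable_compose) measurable
  qed
  then show ?thesis
    unfolding bellman_def[abs_def] using actions_dense(1) by (intro borel_measurable_SUP) auto
qed

lemma nn_integral_p_le_1:
  assumes "\<And>z. z \<in> X \<Longrightarrow> f z \<le> 1" "y \<in> X" "a \<in> A"
  shows "(\<integral>\<^sup>+z. f z \<partial>p y a) \<le> 1"
proof -
  have "(\<integral>\<^sup>+z. f z \<partial>p y a) \<le> (\<integral>\<^sup>+z. 1 \<partial>p y a)"
    using assms p_prob by (intro nn_integral_mono) auto
  also have "\<dots> = 1"
    using prob_space.emeasure_space_1[OF p_prob(4)] assms by simp
  finally show ?thesis .
qed

lemma T_le_1:
  assumes "\<And>z. z \<in> X \<Longrightarrow> f z \<le> 1" "y \<in> X"
  shows "T f y \<le> 1"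
  unfolding bellman_def using actions_dense assms by (intro SUP_least nn_integral_p_le_1) auto

lemma T_mono:
  assumes "\<And>z. z \<in> X \<Longrightarrow> f z \<le> g z" "y \<in> X"
  shows "T f y \<le> T g y"
  unfolding bellman_def using actions_dense(2) assms by (intro SUP_subset_mono nn_integral_mono) (auto simp: subset_iff p_prob(3))

text \<open>Condition (S) speaks of real integrals of bounded real functions. The bound 1 makes
  \<open>f\<close> finite on \<open>X\<close>, so it can be passed through \<open>enn2real\<close>
  and back without changing the integral.\<close>

lemma continuous_nn_integral_p:
  assumes f [measurable]: "f \<in> borel_measurable (stateM X)" and le: "\<And>z. z \<in> X \<Longrightarrow> f z \<le> 1"
    and y: "y \<in> X"
  shows "continuous_on A (\<lambda>a. \<integral>\<^sup>+z. f z \<partial>p y a)"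
proof -
  have le': "enn2real (f z) \<le> 1" if "z \<in> X" for z
    using enn2real_mono[OF le[OF that]] by simp
  have "continuous_on A (\<lambda>a. \<integral>z. enn2real (f z) \<partial>p y a)"
  proof -
    have "bounded ((\<lambda>z. enn2real (f z)) ` X)"
      by (rule boundedI[of _ 1]) (use le' in auto)
    moreover have "(\<lambda>z. enn2real (f z)) \<in> borel_measurable (stateM X)" by measurable
    ultimately show ?thesis using S y unfolding condition_S_def by blast
  qed
  then have "continuous_on A (\<lambda>a. ennreal (\<integral>z. enn2real (f z) \<partial>p y a))"
    by (rule continuous_on_ennreal)
  moreover have "ennreal (\<integral>z. enn2real (f z) \<partial>p y a) = (\<integral>\<^sup>+z. f z \<partial>p y a)" if a: "a \<in> A" for a
  proof -
    have [measurable_cong]: "sets (p y a) = sets (stateM X)" using p_prob y a by auto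
    interpret prob_space "p y a" using p_prob y a by auto
    have "integrable (p y a) (\<lambda>z. enn2real (f z))"
      by (rule integrable_const_bound[where B=1]) (use le' p_prob(3)[OF y a] in auto)
    then have "ennreal (\<integral>z. enn2real (f z) \<partial>p y a) = (\<integral>\<^sup>+z. ennreal (enn2real (f z)) \<partial>p y a)"
      by (subst nn_integral_eq_integral) auto
    also have "\<dots> = (\<integral>\<^sup>+z. f z \<partial>p y a)"
      using le p_prob(3)[OF y a]
      by (intro nn_integral_cong) (force simp: ennreal_enn2real_if top_unique dest: le)
    finally show ?thesis .
  qed
  ultimately show ?thesis by (simp cong: continuous_on_cong)
qed

text \<open>An action outside the dense set is a limit of actions in it; by continuity its integral
  is a limit of terms of the supremum.\<close>

lemma nn_integral_p_le_T:
  assumes f: "f \<in> borel_measurable (stateM X)" and le: "\<And>z. z \<in> X \<Longrightarrow> f z \<le> 1"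
    and y: "y \<in> X" and a: "a \<in> A"
  shows "(\<integral>\<^sup>+z. f z \<partial>p y a) \<le> T f y"
proof -
  have "a \<in> closure actions_dense" using a actions_dense by auto
  then obtain d where d: "\<And>n. d n \<in> actions_dense" "d \<longlonglongrightarrow> a"
    unfolding closure_sequential by blast
  have "(\<lambda>n. \<integral>\<^sup>+z. f z \<partial>p y (d n)) \<longlonglongrightarrow> (\<integral>\<^sup>+z. f z \<partial>p y a)"
    using continuous_on_tendsto_compose[OF continuous_nn_integral_p[OF f le y] d(2) a] d(1) actions_dense(2)
    by (auto simp: subset_iff)
  then show ?thesis
    by (rule LIMSEQ_le_const2) (auto simp: bellman_def intro!: SUP_upper d)
qed

text \<open>This is Dini's theorem on the compact action space.\<close>
lemma T_tendsto_0:
  assumes f: "\<And>n. f n \<in> borel_measurable (stateM X)" and le: "\<And>n z. z \<in> X \<Longrightarrow> f n z \<le> 1"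
    and dec: "\<And>m n z. z \<in> X \<Longrightarrow> m \<le> n \<Longrightarrow> f n z \<le> f m z"
    and lim: "\<And>z. z \<in> X \<Longrightarrow> (\<lambda>n. f n z) \<longlonglongrightarrow> 0"
    and y: "y \<in> X"
  shows "(\<lambda>n. T (f n) y) \<longlonglongrightarrow> 0"
proof -
  define F where "F n a = (\<integral>\<^sup>+z. f n z \<partial>p y a)" for n a
  have F_dec: "F n a \<le> F m a" if "m \<le> n" "a \<in> A" for m n a
    unfolding F_def using that dec p_prob(3)[OF y] by (intro nn_integral_mono) auto
  have F_lim: "(\<lambda>n. F n a) \<longlonglongrightarrow> 0" if a: "a \<in> A" for a
  proof -
    have [measurable_cong]: "sets (p y a) = sets (stateM X)" using p_prob y a by auto
    interpret prob_space "p y a" using p_prob y a by auto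
    have "(\<lambda>n. \<integral>\<^sup>+z. f n z \<partial>p y a) \<longlonglongrightarrow> (\<integral>\<^sup>+z. 0 \<partial>p y a)"
      by (rule nn_integral_dominated_convergence[where w="\<lambda>_. 1"])
        (use f le lim p_prob(3)[OF y a] emeasure_space_1 in auto)
    then show ?thesis by (simp add: F_def)
  qed
  have F_cont: "continuous_on A (F n)" for n
    unfolding F_def by (rule continuous_nn_integral_p[OF f le y])
  show ?thesis
  proof (rule order_tendstoI)
    fix e :: ennreal assume "0 < e"
    then obtain e' where e': "0 < e'" "e' < e" using dense by blast
    have "\<exists>U. open U \<and> A \<inter> U = {a\<in>A. F n a < e'}" for n
    proof -
      have "openin (top_of_set A) (A \<inter> F n -` {..<e'})"
        using F_cont[of n] by (intro continuous_openin_preimage_gen) auto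
      then show ?thesis unfolding openin_open by (auto simp: vimage_def)
    qed
    then obtain U where U: "\<And>n. open (U n)" "\<And>n. A \<inter> U n = {a\<in>A. F n a < e'}" by metis
    have "A \<subseteq> (\<Union>n. U n)"
    proof
      fix a assume a: "a \<in> A"
      obtain n where "F n a < e'"
        using order_tendstoD(2)[OF F_lim[OF a] e'(1)] by (auto simp: eventually_sequentially)
      then show "a \<in> (\<Union>n. U n)" using U(2)[of n] a by auto
    qed
    moreover have "compact A" using S by (simp add: condition_S_def)
    ultimately obtain C where C: "finite C" "A \<subseteq> (\<Union>n\<in>C. U n)"
      using U(1) by (auto elim!: compactE_image[of A UNIV U])
    \<comment> \<open>The sets \<open>U n\<close> cover \<open>A\<close> by compactness with
      finitely many indices; monotonicity in \<open>n\<close> lets the largest of these indices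
      serve every action.\<close>
    have "T (f n) y < e" if n: "n \<ge> Max C" for n
    proof -
      have "T (f n) y \<le> e'" unfolding bellman_def
      proof (rule SUP_least)
        fix d assume "d \<in> actions_dense"
        then have d: "d \<in> A" using actions_dense by auto
        then obtain k where k: "k \<in> C" "d \<in> U k" using C by auto
        then have "F k d < e'" using U(2)[of k] d by auto
        moreover have "k \<le> n" using k C(1) n by (meson Max_ge le_trans)
        ultimately have "F n d \<le> e'" using F_dec[OF _ d, of k n] by auto
        then show "(\<integral>\<^sup>+z. f n z \<partial>p y d) \<le> e'" by (simp add: F_def)
      qed
      then show ?thesis using e' by simp
    qed
    then show "\<forall>\<^sub>F n in sequentially. T (f n) y < e"
      unfolding eventually_sequentially by blast
  qed auto
qed

text \<open>The four properties are proved together because \<open>T_tendsto_0\<close> consumes all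
  of them for the previous power.\<close>

lemma Tpow_decreasing_to_0:
  assumes f: "\<And>n. f n \<in> borel_measurable (stateM X)" and le: "\<And>n z. z \<in> X \<Longrightarrow> f n z \<le> 1"
    and dec: "\<And>m n z. z \<in> X \<Longrightarrow> m \<le> n \<Longrightarrow> f n z \<le> f m z"
    and lim: "\<And>z. z \<in> X \<Longrightarrow> (\<lambda>n. f n z) \<longlonglongrightarrow> 0"
  shows "(\<forall>n. (T ^^ t) (f n) \<in> borel_measurable (stateM X)) \<and>
    (\<forall>n. \<forall>z\<in>X. (T ^^ t) (f n) z \<le> 1) \<and>
    (\<forall>m n. \<forall>z\<in>X. m \<le> n \<longrightarrow> (T ^^ t) (f n) z \<le> (T ^^ t) (f m) z) \<and>
    (\<forall>z\<in>X. (\<lambda>n. (T ^^ t) (f n) z) \<longlonglongrightarrow> 0)"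
proof (induction t)
  case 0
  then show ?case using assms by auto
next
  case (Suc t)
  then show ?case by (auto intro!: T_measurable T_le_1 T_mono T_tendsto_0)
qed

section \<open>Laws of finite histories\<close>

lemma histM_measurable_update [measurable]:
  "(\<lambda>(((f, y), a), z). (f(n := (y, a)), z)) \<in>
     (histM X A n \<Otimes>\<^sub>M stateM A) \<Otimes>\<^sub>M stateM X \<rightarrow>\<^sub>M histM X A (Suc n)"
proof -
  have [measurable]: "(\<lambda>(f, y). f(n := y)) \<in> (PiM {..<n} (\<lambda>_. stateM X \<Otimes>\<^sub>M stateM A)) \<Otimes>\<^sub>M (stateM X \<Otimes>\<^sub>M stateM A)
     \<rightarrow>\<^sub>M PiM {..<Suc n} (\<lambda>_. stateM X \<Otimes>\<^sub>M stateM A)"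
    using measurable_add_dim[of n "{..<n}" "\<lambda>_. stateM X \<Otimes>\<^sub>M stateM A"]
    by (simp add: lessThan_Suc)
  have "(\<lambda>w. ((\<lambda>(f, y). f(n := y)) (fst (fst (fst w)), (snd (fst (fst w)), snd (fst w))), snd w)) \<in>
     (histM X A n \<Otimes>\<^sub>M stateM A) \<Otimes>\<^sub>M stateM X \<rightarrow>\<^sub>M histM X A (Suc n)"
    unfolding histM_def by measurable
  then show ?thesis by (simp add: case_prod_beta')
qed

text \<open>Isolating the transition from one history to the next as a single Markov kernel makes
  \<open>hist_law\<close> an iterated composition of kernels, so measurability and total mass 1
  propagate by induction.\<close>

definition step where
  "step \<pi> n h = \<pi> n h \<bind> (\<lambda>a. p (snd h) a \<bind>
        (\<lambda>z. return (histM X A (Suc n)) ((fst h)(n := (snd h, a)), z)))"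

lemma hist_law_Suc: "hist_law X A p \<pi> x (Suc n) = hist_law X A p \<pi> x n \<bind> step \<pi> n"
  by (simp add: step_def case_prod_beta' cong: bind_cong)

lemma strategies_measurable [measurable (raw)]:
  "\<pi> \<in> strategies X A \<Longrightarrow> \<pi> n \<in> histM X A n \<rightarrow>\<^sub>M prob_algebra (stateM A)"
  by (simp add: strategies_def)

lemma snd_histM [measurable]: "snd \<in> histM X A n \<rightarrow>\<^sub>M stateM X"
  by (simp add: histM_def)

lemma p_snd_measurable:
  "(\<lambda>(h, a). p (snd h) a) \<in> histM X A n \<Otimes>\<^sub>M stateM A \<rightarrow>\<^sub>M prob_algebra (stateM X)"
proof -
  have "(\<lambda>w. (\<lambda>(x, a). p x a) (snd (fst w), snd w)) \<in> histM X A n \<Otimes>\<^sub>M stateM A \<rightarrow>\<^sub>M prob_algebra (stateM X)"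
    by (rule measurable_compose[OF _ p_kernel]) measurable
  then show ?thesis by (simp add: case_prod_beta')
qed

lemma inner_step_measurable:
  "(\<lambda>(h, a). p (snd h) a \<bind> (\<lambda>z. return (histM X A (Suc n)) ((fst h)(n := (snd h, a)), z)))
   \<in> histM X A n \<Otimes>\<^sub>M stateM A \<rightarrow>\<^sub>M prob_algebra (histM X A (Suc n))"
proof -
  have 1: "(\<lambda>w. p (snd (fst w)) (snd w)) \<in> histM X A n \<Otimes>\<^sub>M stateM A \<rightarrow>\<^sub>M prob_algebra (stateM X)"
    using p_snd_measurable by (simp add: case_prod_beta')
  have 2: "(\<lambda>(w, z). return (histM X A (Suc n)) ((fst (fst w))(n := (snd (fst w), snd w)), z))
     \<in> (histM X A n \<Otimes>\<^sub>M stateM A) \<Otimes>\<^sub>M stateM X \<rightarrow>\<^sub>M prob_algebra (histM X A (Suc n))"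
    using measurable_compose[OF histM_measurable_update measurable_return_prob_space]
    by (simp add: case_prod_beta')
  show ?thesis
    using measurable_bind_prob_space2[OF 1 2] by (simp add: case_prod_beta')
qed

lemma step_measurable:
  assumes "\<pi> \<in> strategies X A"
  shows "step \<pi> n \<in> histM X A n \<rightarrow>\<^sub>M prob_algebra (histM X A (Suc n))"
  unfolding step_def[abs_def]
  by (rule measurable_bind_prob_space2[OF strategies_measurable[OF assms] inner_step_measurable])

lemma hist_law_in:
  assumes "\<pi> \<in> strategies X A" "x \<in> X"
  shows "hist_law X A p \<pi> x n \<in> space (prob_algebra (histM X A n))"
proof (induction n)
  case 0
  \<comment> \<open>At time 0 the product over the empty index set has exactly one point, the
    function that is \<open>undefined\<close> everywhere.\<close>
  have "(\<lambda>_. undefined, x) \<in> space (histM X A 0)"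
    using assms by (auto simp: histM_def space_pair_measure space_PiM)
  then show ?case by (simp add: space_prob_algebra prob_space_return)
next
  case (Suc n)
  \<comment> \<open>The measure is viewed as a constant kernel, so that the composition rule for
    probability kernels yields membership in \<open>prob_algebra\<close>.\<close>
  have "(\<lambda>_. hist_law X A p \<pi> x n \<bind> step \<pi> n) \<in> count_space UNIV \<rightarrow>\<^sub>M prob_algebra (histM X A (Suc n))"
    by (rule measurable_bind_prob_space[OF measurable_const[OF Suc] step_measurable[OF assms(1)]])
  from measurable_space[OF this, of undefined] show ?case
    by (simp only: hist_law_Suc space_count_space UNIV_I)
qed

lemma hist_law_sets:
  assumes "\<pi> \<in> strategies X A" "x \<in> X"
  shows "sets (hist_law X A p \<pi> x n) = sets (histM X A n)"
    "space (hist_law X A p \<pi> x n) = space (histM X A n)"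
    "prob_space (hist_law X A p \<pi> x n)"
  using hist_law_in[OF assms, of n] sets_eq_imp_space_eq by (auto simp: space_prob_algebra)

lemma strategy_prob:
  assumes "\<pi> \<in> strategies X A" "h \<in> space (histM X A n)"
  shows "sets (\<pi> n h) = sets (stateM A)" "space (\<pi> n h) = A" "prob_space (\<pi> n h)"
proof -
  have "\<pi> n h \<in> space (prob_algebra (stateM A))"
    using measurable_space[OF strategies_measurable[OF assms(1)] assms(2)] .
  then show 1: "sets (\<pi> n h) = sets (stateM A)" "prob_space (\<pi> n h)" by (auto simp: space_prob_algebra)
  show "space (\<pi> n h) = A" using sets_eq_imp_space_eq[OF 1(1)] by simp
qed

text \<open>The last transition becomes an iterated integral, first over the action and then over
  the next state. The inductions over time, for the bound by powers of \<open>T\<close> and for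
  absorption, rest on this formula.\<close>

lemma nn_integral_hist_law_Suc:
  assumes \<pi>: "\<pi> \<in> strategies X A" and x: "x \<in> X"
    and f [measurable]: "f \<in> borel_measurable (histM X A (Suc n))"
  shows "(\<integral>\<^sup>+h. f h \<partial>hist_law X A p \<pi> x (Suc n)) =
    (\<integral>\<^sup>+h. \<integral>\<^sup>+a. \<integral>\<^sup>+z. f ((fst h)(n := (snd h, a)), z) \<partial>p (snd h) a \<partial>\<pi> n h \<partial>hist_law X A p \<pi> x n)"
proof -
  have [measurable_cong]: "sets (hist_law X A p \<pi> x n) = sets (histM X A n)"
    using hist_law_sets \<pi> x by auto
  have "(\<integral>\<^sup>+h. f h \<partial>hist_law X A p \<pi> x (Suc n)) =
     (\<integral>\<^sup>+h. \<integral>\<^sup>+h'. f h' \<partial>step \<pi> n h \<partial>hist_law X A p \<pi> x n)"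
    unfolding hist_law_Suc
    by (rule nn_integral_bind[OF f]) (use measurable_prob_algebraD[OF step_measurable[OF \<pi>]] in measurable)
  also have "\<dots> = (\<integral>\<^sup>+h. \<integral>\<^sup>+a. \<integral>\<^sup>+z. f ((fst h)(n := (snd h, a)), z) \<partial>p (snd h) a \<partial>\<pi> n h \<partial>hist_law X A p \<pi> x n)"
  proof (rule nn_integral_cong)
    fix h assume "h \<in> space (hist_law X A p \<pi> x n)"
    then have h: "h \<in> space (histM X A n)" using hist_law_sets \<pi> x by auto
    have sh: "snd h \<in> X" using measurable_space[OF snd_histM h] by simp
    have [measurable_cong]: "sets (\<pi> n h) = sets (stateM A)" using strategy_prob \<pi> h by auto
    have "(\<lambda>a. (\<lambda>(h, a). p (snd h) a \<bind> (\<lambda>z. return (histM X A (Suc n)) ((fst h)(n := (snd h, a)), z))) (h, a))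
       \<in> stateM A \<rightarrow>\<^sub>M prob_algebra (histM X A (Suc n))"
      by (rule measurable_compose[OF _ inner_step_measurable]) (use h in measurable)
    then have 1: "(\<lambda>a. p (snd h) a \<bind> (\<lambda>z. return (histM X A (Suc n)) ((fst h)(n := (snd h, a)), z)))
       \<in> \<pi> n h \<rightarrow>\<^sub>M subprob_algebra (histM X A (Suc n))"
      by (simp add: measurable_prob_algebraD)
    have "(\<integral>\<^sup>+h'. f h' \<partial>step \<pi> n h) =
      (\<integral>\<^sup>+a. \<integral>\<^sup>+h'. f h' \<partial>(p (snd h) a \<bind> (\<lambda>z. return (histM X A (Suc n)) ((fst h)(n := (snd h, a)), z))) \<partial>\<pi> n h)"
      unfolding step_def by (rule nn_integral_bind[OF f 1])
    also have "\<dots> = (\<integral>\<^sup>+a. \<integral>\<^sup>+z. f ((fst h)(n := (snd h, a)), z) \<partial>p (snd h) a \<partial>\<pi> n h)"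
    proof (rule nn_integral_cong)
      fix a assume "a \<in> space (\<pi> n h)"
      then have a: "a \<in> A" using strategy_prob \<pi> h by auto
      have [measurable_cong]: "sets (p (snd h) a) = sets (stateM X)" using p_prob sh a by auto
      have "(\<lambda>z. (\<lambda>(((f, y), a), z). (f(n := (y, a)), z)) ((h, a), z)) \<in> stateM X \<rightarrow>\<^sub>M histM X A (Suc n)"
        by (rule measurable_compose[OF _ histM_measurable_update]) (use h a in \<open>auto intro!: measurable_Pair simp: space_pair_measure\<close>)
      then have upd: "(\<lambda>z. ((fst h)(n := (snd h, a)), z)) \<in> p (snd h) a \<rightarrow>\<^sub>M histM X A (Suc n)"
        by (simp add: case_prod_beta')
      have "(\<integral>\<^sup>+h'. f h' \<partial>(p (snd h) a \<bind> (\<lambda>z. return (histM X A (Suc n)) ((fst h)(n := (snd h, a)), z)))) =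
         (\<integral>\<^sup>+z. \<integral>\<^sup>+h'. f h' \<partial>return (histM X A (Suc n)) ((fst h)(n := (snd h, a)), z) \<partial>p (snd h) a)"
        by (rule nn_integral_bind[OF f measurable_compose[OF upd return_measurable]])
      also have "\<dots> = (\<integral>\<^sup>+z. f ((fst h)(n := (snd h, a)), z) \<partial>p (snd h) a)"
        using measurable_space[OF upd] by (intro nn_integral_cong nn_integral_return) auto
      finally show "(\<integral>\<^sup>+h'. f h' \<partial>(p (snd h) a \<bind> (\<lambda>z. return (histM X A (Suc n)) ((fst h)(n := (snd h, a)), z)))) =
         (\<integral>\<^sup>+z. f ((fst h)(n := (snd h, a)), z) \<partial>p (snd h) a)" .
    qed
    finally show "(\<integral>\<^sup>+h'. f h' \<partial>step \<pi> n h) = \<dots>" .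
  qed
  finally show ?thesis .
qed

text \<open>Given a history, the mean of \<open>f\<close> at the next state averages kernel
  integrals over actions, hence is at most \<open>T f\<close> at the current state, whatever the
  strategy remembers. The induction hypothesis is then used for \<open>T f\<close>, which is why
  \<open>f\<close> varies in the induction. The right-hand side is independent of the
  strategy.\<close>

lemma nn_integral_state_le_Tpow:
  assumes \<pi>: "\<pi> \<in> strategies X A" and x: "x \<in> X"
    and f: "f \<in> borel_measurable (stateM X)" and le: "\<And>z. z \<in> X \<Longrightarrow> f z \<le> 1"
  shows "(\<integral>\<^sup>+h. f (snd h) \<partial>hist_law X A p \<pi> x t) \<le> (T ^^ t) f x"
  using f le
proof (induction t arbitrary: f)
  case 0
  have "(\<lambda>_. undefined, x) \<in> space (histM X A 0)"
    using x by (auto simp: histM_def space_pair_measure space_PiM)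
  moreover have "(\<lambda>h. f (snd h)) \<in> borel_measurable (histM X A 0)"
    using 0 by measurable
  ultimately show ?case by (simp add: nn_integral_return)
next
  case (Suc t)
  have m: "(\<lambda>h. f (snd h)) \<in> borel_measurable (histM X A (Suc t))"
    using Suc.prems(1) by measurable
  have "(\<integral>\<^sup>+h. f (snd h) \<partial>hist_law X A p \<pi> x (Suc t)) =
     (\<integral>\<^sup>+h. \<integral>\<^sup>+a. \<integral>\<^sup>+z. f z \<partial>p (snd h) a \<partial>\<pi> t h \<partial>hist_law X A p \<pi> x t)"
    by (subst nn_integral_hist_law_Suc[OF \<pi> x m]) simp
  also have "\<dots> \<le> (\<integral>\<^sup>+h. T f (snd h) \<partial>hist_law X A p \<pi> x t)"
  proof (rule nn_integral_mono)
    fix h assume "h \<in> space (hist_law X A p \<pi> x t)"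
    then have h: "h \<in> space (histM X A t)" using hist_law_sets \<pi> x by auto
    have sh: "snd h \<in> X" using measurable_space[OF snd_histM h] by simp
    have "(\<integral>\<^sup>+a. \<integral>\<^sup>+z. f z \<partial>p (snd h) a \<partial>\<pi> t h) \<le> (\<integral>\<^sup>+a. T f (snd h) \<partial>\<pi> t h)"
      using strategy_prob[OF \<pi> h] Suc.prems sh by (intro nn_integral_mono nn_integral_p_le_T) auto
    also have "\<dots> = T f (snd h)"
      using prob_space.emeasure_space_1[OF strategy_prob(3)[OF \<pi> h]] by simp
    finally show "(\<integral>\<^sup>+a. \<integral>\<^sup>+z. f z \<partial>p (snd h) a \<partial>\<pi> t h) \<le> T f (snd h)" .
  qed
  also have "\<dots> \<le> (T ^^ t) (T f) x"
    using Suc.prems by (intro Suc.IH T_measurable T_le_1)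
  finally show ?case by (simp add: funpow_swap1)
qed

lemma nn_integral_pair_law:
  assumes \<pi>: "\<pi> \<in> strategies X A" and x: "x \<in> X"
    and f [measurable]: "f \<in> borel_measurable (stateM X \<Otimes>\<^sub>M stateM A)"
  shows "(\<integral>\<^sup>+w. f w \<partial>pair_law X A p \<pi> x n) =
    (\<integral>\<^sup>+h. \<integral>\<^sup>+a. f (snd h, a) \<partial>\<pi> n h \<partial>hist_law X A p \<pi> x n)"
proof -
  have [measurable_cong]: "sets (hist_law X A p \<pi> x n) = sets (histM X A n)"
    using hist_law_sets \<pi> x by auto
  have 1: "(\<lambda>h. distr (\<pi> n h) (stateM X \<Otimes>\<^sub>M stateM A) (\<lambda>a. (snd h, a)))
      \<in> histM X A n \<rightarrow>\<^sub>M prob_algebra (stateM X \<Otimes>\<^sub>M stateM A)"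
    by (rule measurable_distr_prob_space2[OF strategies_measurable[OF \<pi>]]) measurable
  have "(\<integral>\<^sup>+w. f w \<partial>pair_law X A p \<pi> x n) =
    (\<integral>\<^sup>+h. \<integral>\<^sup>+w. f w \<partial>distr (\<pi> n h) (stateM X \<Otimes>\<^sub>M stateM A) (\<lambda>a. (snd h, a)) \<partial>hist_law X A p \<pi> x n)"
    unfolding pair_law_def case_prod_beta' prod.collapse
    by (rule nn_integral_bind[OF f]) (use measurable_prob_algebraD[OF 1] in measurable)
  also have "\<dots> = (\<integral>\<^sup>+h. \<integral>\<^sup>+a. f (snd h, a) \<partial>\<pi> n h \<partial>hist_law X A p \<pi> x n)"
  proof (rule nn_integral_cong)
    fix h assume "h \<in> space (hist_law X A p \<pi> x n)"
    then have h: "h \<in> space (histM X A n)" using hist_law_sets \<pi> x by auto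
    have sh: "snd h \<in> space (stateM X)" using measurable_space[OF snd_histM h] .
    have [measurable_cong]: "sets (\<pi> n h) = sets (stateM A)" using strategy_prob \<pi> h by auto
    have m: "(\<lambda>a. (snd h, a)) \<in> \<pi> n h \<rightarrow>\<^sub>M stateM X \<Otimes>\<^sub>M stateM A"
      using sh by measurable
    show "(\<integral>\<^sup>+w. f w \<partial>distr (\<pi> n h) (stateM X \<Otimes>\<^sub>M stateM A) (\<lambda>a. (snd h, a))) =
      (\<integral>\<^sup>+a. f (snd h, a) \<partial>\<pi> n h)"
      by (rule nn_integral_distr[OF m]) (use f in simp)
  qed
  finally show ?thesis .
qed

lemma sets_pair_law:
  assumes \<pi>: "\<pi> \<in> strategies X A" and x: "x \<in> X"
  shows "sets (pair_law X A p \<pi> x n) = sets (stateM X \<Otimes>\<^sub>M stateM A)"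
proof -
  have "(\<lambda>h. distr (\<pi> n h) (stateM X \<Otimes>\<^sub>M stateM A) (\<lambda>a. (snd h, a)))
      \<in> histM X A n \<rightarrow>\<^sub>M prob_algebra (stateM X \<Otimes>\<^sub>M stateM A)"
    by (rule measurable_distr_prob_space2[OF strategies_measurable[OF \<pi>]]) measurable
  from sets_bind'[OF hist_law_in[OF \<pi> x] this] show ?thesis
    unfolding pair_law_def case_prod_beta' prod.collapse .
qed

section \<open>Absorption at \<open>\<Delta>\<close> and survival\<close>

lemma Delta_measurable [measurable]: "{\<Delta>} \<in> sets (stateM X)"
proof -
  have "{\<Delta>} = X \<inter> {\<Delta>}" by (auto simp: X_eq)
  then show ?thesis
    unfolding stateM_def sets_restrict_space by (rule image_eqI) (rule borel_singleton, simp)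
qed

lemma histM_state_measurable:
  assumes "i < t"
  shows "(\<lambda>h. fst (fst h i)) \<in> histM X A t \<rightarrow>\<^sub>M stateM X"
proof -
  have "(\<lambda>f. f i) \<in> PiM {..<t} (\<lambda>_. stateM X \<Otimes>\<^sub>M stateM A) \<rightarrow>\<^sub>M stateM X \<Otimes>\<^sub>M stateM A"
    using assms by (intro measurable_component_singleton) auto
  then show ?thesis
    unfolding histM_def by (intro measurable_compose[OF _ measurable_fst] measurable_compose[OF measurable_fst])
qed

lemma visited_Delta_sets:
  "{h \<in> space (histM X A t). \<exists>i<t. fst (fst h i) = \<Delta>} \<in> sets (histM X A t)"
proof -
  have "{h \<in> space (histM X A t). \<exists>i<t. fst (fst h i) = \<Delta>} =
    (\<Union>i\<in>{..<t}. (\<lambda>h. fst (fst h i)) -` {\<Delta>} \<inter> space (histM X A t))" by auto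
  also have "\<dots> \<in> sets (histM X A t)"
    by (intro sets.finite_UN measurable_sets[OF histM_state_measurable Delta_measurable]) auto
  finally show ?thesis .
qed

lemma at_Delta_sets: "{h \<in> space (histM X A t). snd h = \<Delta>} \<in> sets (histM X A t)"
  using measurable_sets[OF snd_histM[of t] Delta_measurable] by (simp add: vimage_def Int_def conj_commute)

lemma left_Delta_measurable:
  "(indicator {h. (\<exists>i<t. fst (fst h i) = \<Delta>) \<and> snd h \<noteq> \<Delta>} :: _ \<Rightarrow> ennreal)
     \<in> borel_measurable (histM X A t)"
proof -
  have eq: "{h. (\<exists>i<t. fst (fst h i) = \<Delta>) \<and> snd h \<noteq> \<Delta>} \<inter> space (histM X A t) =
    {h \<in> space (histM X A t). \<exists>i<t. fst (fst h i) = \<Delta>} - {h \<in> space (histM X A t). snd h = \<Delta>}" by auto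
  show ?thesis
    unfolding borel_measurable_indicator_iff eq by (rule sets.Diff[OF visited_Delta_sets at_Delta_sets])
qed

lemma surviving_sets:
  "{h \<in> space (histM X A t). (\<forall>i<t. fst (fst h i) \<noteq> \<Delta>) \<and> snd h \<noteq> \<Delta>} \<in> sets (histM X A t)"
proof -
  have eq: "{h \<in> space (histM X A t). (\<forall>i<t. fst (fst h i) \<noteq> \<Delta>) \<and> snd h \<noteq> \<Delta>} =
    space (histM X A t) - {h \<in> space (histM X A t). \<exists>i<t. fst (fst h i) = \<Delta>} -
      {h \<in> space (histM X A t). snd h = \<Delta>}" by auto
  show ?thesis
    unfolding eq by (rule sets.Diff[OF sets.Diff[OF sets.top visited_Delta_sets] at_Delta_sets])
qed

text \<open>\<open>surv_prob\<close> excludes \<open>\<Delta>\<close> at all times up to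
  \<open>t\<close>, whereas the occupation measure looks only at the current state. The event here
  is the gap between the two, and its probability does not increase in one transition.\<close>

lemma hist_law_leaves_Delta_null:
  assumes \<pi>: "\<pi> \<in> strategies X A" and x: "x \<in> X"
  shows "(\<integral>\<^sup>+h. indicator {h. (\<exists>i<t. fst (fst h i) = \<Delta>) \<and> snd h \<noteq> \<Delta>} h \<partial>hist_law X A p \<pi> x t) = 0"
proof (induction t)
  case 0
  then show ?case by simp
next
  case (Suc t)
  let ?W = "\<lambda>t. {h. (\<exists>i<t. fst (fst h i) = \<Delta>) \<and> snd h \<noteq> \<Delta>} :: ((nat \<Rightarrow> 'x \<times> 'a) \<times> 'x) set"
  have "(\<integral>\<^sup>+h. indicator (?W (Suc t)) h \<partial>hist_law X A p \<pi> x (Suc t)) =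
     (\<integral>\<^sup>+h. \<integral>\<^sup>+a. \<integral>\<^sup>+z. indicator (?W (Suc t)) ((fst h)(t := (snd h, a)), z) \<partial>p (snd h) a \<partial>\<pi> t h \<partial>hist_law X A p \<pi> x t)"
    by (rule nn_integral_hist_law_Suc[OF \<pi> x left_Delta_measurable])
  also have "\<dots> \<le> (\<integral>\<^sup>+h. indicator (?W t) h \<partial>hist_law X A p \<pi> x t)"
  proof (rule nn_integral_mono)
    fix h assume "h \<in> space (hist_law X A p \<pi> x t)"
    then have h: "h \<in> space (histM X A t)" using hist_law_sets \<pi> x by auto
    have sh: "snd h \<in> X" using measurable_space[OF snd_histM h] by simp
    have "(\<integral>\<^sup>+z. indicator (?W (Suc t)) ((fst h)(t := (snd h, a)), z) \<partial>p (snd h) a) \<le> indicator (?W t) h"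
      if a: "a \<in> A" for a
    \<comment> \<open>From \<open>\<Delta>\<close>, moving elsewhere has probability 0. From any
      other state, a visit to \<open>\<Delta>\<close> before time \<open>Suc t\<close> is a visit
      before time \<open>t\<close>, so the history already lay in the event.\<close>
    proof (cases "snd h = \<Delta>")
      case True
      interpret prob_space "p (snd h) a" using p_prob sh a by auto
      have "(\<integral>\<^sup>+z. indicator (?W (Suc t)) ((fst h)(t := (snd h, a)), z) \<partial>p (snd h) a) \<le>
         (\<integral>\<^sup>+z. indicator (X - {\<Delta>}) z \<partial>p (snd h) a)"
        using p_prob(3)[OF sh a] by (intro nn_integral_mono) (auto split: split_indicator)
      also have "\<dots> = emeasure (p (snd h) a) (X - {\<Delta>})"
        using p_prob(2)[OF sh a] sets.compl_sets[OF Delta_measurable] by (intro nn_integral_indicator) simp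
      also have "\<dots> = 0"
        using emeasure_compl[of "{\<Delta>}" "p (snd h) a"] p_prob(2,3)[OF sh a] Delta_measurable True
          Delta_absorb a emeasure_space_1 by simp
      finally show ?thesis by simp
    next
      case False
      have "(\<integral>\<^sup>+z. indicator (?W (Suc t)) ((fst h)(t := (snd h, a)), z) \<partial>p (snd h) a) \<le>
         (\<integral>\<^sup>+z. indicator (?W t) h \<partial>p (snd h) a)"
        using False by (intro nn_integral_mono) (auto split: split_indicator simp: less_Suc_eq)
      also have "\<dots> = indicator (?W t) h"
        using prob_space.emeasure_space_1[OF p_prob(4)[OF sh a]] by simp
      finally show ?thesis .
    qed
    then have "(\<integral>\<^sup>+a. \<integral>\<^sup>+z. indicator (?W (Suc t)) ((fst h)(t := (snd h, a)), z) \<partial>p (snd h) a \<partial>\<pi> t h) \<le>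
      (\<integral>\<^sup>+a. indicator (?W t) h \<partial>\<pi> t h)"
      using strategy_prob(2)[OF \<pi> h] by (intro nn_integral_mono) auto
    also have "\<dots> = indicator (?W t) h"
      using prob_space.emeasure_space_1[OF strategy_prob(3)[OF \<pi> h]] by simp
    finally show "(\<integral>\<^sup>+a. \<integral>\<^sup>+z. indicator (?W (Suc t)) ((fst h)(t := (snd h, a)), z) \<partial>p (snd h) a \<partial>\<pi> t h) \<le>
      indicator (?W t) h" .
  qed
  also have "\<dots> = 0" by (rule Suc.IH)
  finally show ?case by simp
qed

text \<open>Being in \<open>Y\<close> at time \<open>t\<close> means having avoided
  \<open>\<Delta>\<close> throughout or having returned from it, and the second event is
  null.\<close>

lemma occupied_le_surv_prob:
  assumes \<pi>: "\<pi> \<in> strategies X A" and x: "x \<in> X"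
  shows "(\<integral>\<^sup>+h. indicator Y (snd h) \<partial>hist_law X A p \<pi> x t) \<le> surv_prob X A p \<Delta> \<pi> x t"
proof -
  let ?W = "{h. (\<exists>i<t. fst (fst h i) = \<Delta>) \<and> snd h \<noteq> \<Delta>} :: ((nat \<Rightarrow> 'x \<times> 'a) \<times> 'x) set"
  let ?V = "{h \<in> space (histM X A t). (\<forall>i<t. fst (fst h i) \<noteq> \<Delta>) \<and> snd h \<noteq> \<Delta>}"
  have mcong: "borel_measurable (hist_law X A p \<pi> x t) = borel_measurable (histM X A t)"
    by (rule measurable_cong_sets[OF hist_law_sets(1)[OF \<pi> x] refl])
  have "(\<integral>\<^sup>+h. indicator Y (snd h) \<partial>hist_law X A p \<pi> x t) \<le>
     (\<integral>\<^sup>+h. indicator ?V h + indicator ?W h \<partial>hist_law X A p \<pi> x t)"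
    using Delta_notin hist_law_sets(2)[OF \<pi> x] by (intro nn_integral_mono) (auto split: split_indicator)
  also have "\<dots> = (\<integral>\<^sup>+h. indicator ?V h \<partial>hist_law X A p \<pi> x t) + (\<integral>\<^sup>+h. indicator ?W h \<partial>hist_law X A p \<pi> x t)"
    by (rule nn_integral_add) (simp_all only: mcong left_Delta_measurable borel_measurable_indicator surviving_sets)
  also have "\<dots> = surv_prob X A p \<Delta> \<pi> x t"
    unfolding hist_law_leaves_Delta_null[OF \<pi> x] surv_prob_def add_0_right
    by (rule nn_integral_indicator) (simp only: hist_law_sets(1)[OF \<pi> x] surviving_sets)
  finally show ?thesis .
qed

section \<open>Occupation measures and integration against them\<close>

lemma id_restrict_measurable:
  "(\<lambda>w. w) \<in> restrict_space (stateM X \<Otimes>\<^sub>M stateM A) (Y \<times> A) \<rightarrow>\<^sub>M stateM Y \<Otimes>\<^sub>M stateM A"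
proof -
  have X: "(\<lambda>x. x) \<in> stateM X \<rightarrow>\<^sub>M borel"
    unfolding stateM_def by (auto intro: measurable_restrict_space1)
  have 1: "fst \<in> restrict_space (stateM X \<Otimes>\<^sub>M stateM A) (Y \<times> A) \<rightarrow>\<^sub>M stateM Y"
    unfolding stateM_def[of Y]
    by (rule measurable_restrict_space2)
      (use X in \<open>auto simp: space_restrict_space intro!: measurable_restrict_space1 measurable_compose[OF measurable_fst]\<close>)
  have 2: "snd \<in> restrict_space (stateM X \<Otimes>\<^sub>M stateM A) (Y \<times> A) \<rightarrow>\<^sub>M stateM A"
    by (intro measurable_restrict_space1) measurable
  show ?thesis using measurable_Pair[OF 1 2] by simp
qed

lemma Y_A_measurable: "Y \<times> A \<in> sets (stateM X \<Otimes>\<^sub>M stateM A)"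
proof -
  have "Y \<in> sets (stateM X)"
    using Y_borel by (auto simp: stateM_def sets_restrict_space X_eq intro!: image_eqI[of _ _ Y])
  moreover have "A \<in> sets (stateM A)"
    using sets.top[of "stateM A"] by simp
  ultimately show ?thesis by auto
qed

text \<open>\<open>pair_law\<close> lives on \<open>X \<times> A\<close> while
  \<open>occupation\<close> is defined on subsets of \<open>Y \<times> A\<close>. A set not
  measurable for \<open>pair_law\<close> would receive the default mass 0, so measurability has to
  be transferred along the inclusion.\<close>

lemma sets_YA_subset: "C \<in> sets (stateM Y \<Otimes>\<^sub>M stateM A) \<Longrightarrow> C \<in> sets (stateM X \<Otimes>\<^sub>M stateM A)"
proof -
  assume C: "C \<in> sets (stateM Y \<Otimes>\<^sub>M stateM A)"
  have CYA: "C \<subseteq> Y \<times> A" using sets.sets_into_space[OF C] by (simp add: space_pair_measure)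
  have sp: "space (restrict_space (stateM X \<Otimes>\<^sub>M stateM A) (Y \<times> A)) = Y \<times> A"
    by (auto simp: space_restrict_space space_pair_measure X_eq)
  have "C \<in> sets (restrict_space (stateM X \<Otimes>\<^sub>M stateM A) (Y \<times> A))"
    using measurable_sets[OF id_restrict_measurable C] CYA unfolding sp by (simp add: Int_absorb2)
  then show ?thesis
    using Y_A_measurable by (subst (asm) sets_restrict_space_iff) (auto simp: Int_absorb1 dest: sets.Int)
qed

lemma extend_by_0_measurable:
  assumes "f \<in> borel_measurable (stateM Y \<Otimes>\<^sub>M stateM A)"
  shows "(\<lambda>w. f w * indicator (Y \<times> A) w :: ennreal) \<in> borel_measurable (stateM X \<Otimes>\<^sub>M stateM A)"
  by (rule iffD1[OF borel_measurable_restrict_space_iff_ennreal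
        measurable_compose[OF id_restrict_measurable assms]])
    (rule sets.Int[OF Y_A_measurable sets.top])

text \<open>\<open>measure_of\<close> falls back to the zero measure unless the given set function
  is positive and countably additive. Additivity comes from that of each \<open>pair_law\<close> by
  exchanging the two sums.\<close>

lemma emeasure_occupation:
  assumes \<pi>: "\<pi> \<in> strategies X A" and x: "x \<in> X" and C: "C \<in> sets (stateM Y \<Otimes>\<^sub>M stateM A)"
  shows "emeasure (occupation X Y A p \<pi> x) C = (\<Sum>n. emeasure (pair_law X A p \<pi> x n) C)"
proof (rule emeasure_measure_of[OF occupation_def])
  show "sets (stateM Y \<Otimes>\<^sub>M stateM A) \<subseteq> Pow (space (stateM Y \<Otimes>\<^sub>M stateM A))"
    by (rule sets.space_closed)
  show "C \<in> sets (occupation X Y A p \<pi> x)" using C by (simp add: occupation_def)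
  show "positive (sets (occupation X Y A p \<pi> x)) (\<lambda>C. \<Sum>n. emeasure (pair_law X A p \<pi> x n) C)"
    by (simp add: positive_def)
  show "countably_additive (sets (occupation X Y A p \<pi> x)) (\<lambda>C. \<Sum>n. emeasure (pair_law X A p \<pi> x n) C)"
  proof (rule countably_additiveI)
    fix B :: "nat \<Rightarrow> ('x \<times> 'a) set"
    assume B: "range B \<subseteq> sets (occupation X Y A p \<pi> x)" "disjoint_family B"
    have "range B \<subseteq> sets (pair_law X A p \<pi> x n)" for n
      using B(1) sets_YA_subset unfolding sets_pair_law[OF \<pi> x] by (auto simp: occupation_def)
    then have "emeasure (pair_law X A p \<pi> x n) (\<Union>i. B i) = (\<Sum>i. emeasure (pair_law X A p \<pi> x n) (B i))" for n
      using suminf_emeasure[OF _ B(2)] by simp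
    then show "(\<Sum>i. \<Sum>n. emeasure (pair_law X A p \<pi> x n) (B i)) = (\<Sum>n. emeasure (pair_law X A p \<pi> x n) (\<Union>i. B i))"
      by (simp only: ennreal_suminf_swap[of "\<lambda>i n. emeasure (pair_law X A p \<pi> x n) (B i)"])
  qed
qed

lemma sets_occupation [simp, measurable_cong]:
  "sets (occupation X Y A p \<pi> x) = sets (stateM Y \<Otimes>\<^sub>M stateM A)"
  by (simp add: occupation_def)

text \<open>The formula holds for indicators and extends by linearity and monotone limits. The
  indicator factor extends \<open>f\<close> by 0 from \<open>Y \<times> A\<close> to the space of
  \<open>pair_law\<close>.\<close>

lemma nn_integral_occupation:
  assumes \<pi>: "\<pi> \<in> strategies X A" and x: "x \<in> X"
    and f: "f \<in> borel_measurable (stateM Y \<Otimes>\<^sub>M stateM A)"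
  shows "(\<integral>\<^sup>+w. f w \<partial>occupation X Y A p \<pi> x) =
    (\<Sum>n. \<integral>\<^sup>+w. f w * indicator (Y \<times> A) w \<partial>pair_law X A p \<pi> x n)"
proof -
  have [measurable_cong]: "sets (pair_law X A p \<pi> x n) = sets (stateM X \<Otimes>\<^sub>M stateM A)" for n
    by (rule sets_pair_law[OF \<pi> x])
  from f show ?thesis
  proof (induction rule: borel_measurable_induct)
    case (cong f g)
    moreover have "(\<integral>\<^sup>+w. f w \<partial>occupation X Y A p \<pi> x) = (\<integral>\<^sup>+w. g w \<partial>occupation X Y A p \<pi> x)"
      using cong(3) sets_eq_imp_space_eq[OF sets_occupation] by (intro nn_integral_cong) auto
    moreover have "(\<integral>\<^sup>+w. f w * indicator (Y \<times> A) w \<partial>pair_law X A p \<pi> x n) =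
        (\<integral>\<^sup>+w. g w * indicator (Y \<times> A) w \<partial>pair_law X A p \<pi> x n)" for n
      using cong(3) by (intro nn_integral_cong) (auto simp: space_pair_measure split: split_indicator)
    ultimately show ?case by simp
  next
    case (set C)
    have "indicator C w * indicator (Y \<times> A) w = (indicator C w :: ennreal)" for w
      using sets.sets_into_space[OF set] by (auto simp: space_pair_measure split: split_indicator)
    then show ?case
      using set sets_YA_subset[OF set] by (simp add: emeasure_occupation[OF \<pi> x set])
  next
    case (mult u c)
    note [measurable] = mult(2) extend_by_0_measurable[OF mult(2)]
    have "(\<integral>\<^sup>+w. c * u w * indicator (Y \<times> A) w \<partial>pair_law X A p \<pi> x n) =
      c * (\<integral>\<^sup>+w. u w * indicator (Y \<times> A) w \<partial>pair_law X A p \<pi> x n)" for n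
      unfolding mult.assoc by (rule nn_integral_cmult) measurable
    then show ?case using mult by (simp add: nn_integral_cmult)
  next
    case (add u v)
    note [measurable] = add(1,3) extend_by_0_measurable[OF add(1)] extend_by_0_measurable[OF add(3)]
    have "(\<integral>\<^sup>+w. (v w + u w) * indicator (Y \<times> A) w \<partial>pair_law X A p \<pi> x n) =
      (\<integral>\<^sup>+w. v w * indicator (Y \<times> A) w \<partial>pair_law X A p \<pi> x n) +
      (\<integral>\<^sup>+w. u w * indicator (Y \<times> A) w \<partial>pair_law X A p \<pi> x n)" for n
      unfolding distrib_right by (rule nn_integral_add) measurable
    then show ?case using add by (simp add: nn_integral_add suminf_add)
  next
    case (seq U)
    note [measurable] = seq(1) extend_by_0_measurable[OF seq(1)]
    have "(\<integral>\<^sup>+w. (SUP i. U i) w \<partial>occupation X Y A p \<pi> x) = (SUP i. \<integral>\<^sup>+w. U i w \<partial>occupation X Y A p \<pi> x)"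
      unfolding SUP_apply by (rule nn_integral_monotone_convergence_SUP[OF seq(3)]) measurable
    also have "\<dots> = (SUP i. \<Sum>n. \<integral>\<^sup>+w. U i w * indicator (Y \<times> A) w \<partial>pair_law X A p \<pi> x n)"
      using seq by simp
    also have "\<dots> = (\<Sum>n. SUP i. \<integral>\<^sup>+w. U i w * indicator (Y \<times> A) w \<partial>pair_law X A p \<pi> x n)"
      using seq(3) by (intro ennreal_suminf_SUP_eq[symmetric])
        (auto simp: incseq_def le_fun_def intro!: nn_integral_mono mult_right_mono)
    also have "\<dots> = (\<Sum>n. \<integral>\<^sup>+w. (SUP i. U i w * indicator (Y \<times> A) w) \<partial>pair_law X A p \<pi> x n)"
    proof (intro suminf_cong nn_integral_monotone_convergence_SUP[symmetric])
      show "incseq (\<lambda>i w. U i w * indicator (Y \<times> A) w)"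
        using seq(3) by (auto simp: incseq_def le_fun_def intro!: mult_right_mono)
    qed measurable
    also have "\<dots> = (\<Sum>n. \<integral>\<^sup>+w. (SUP i. U i) w * indicator (Y \<times> A) w \<partial>pair_law X A p \<pi> x n)"
      unfolding SUP_apply SUP_mult_right_ennreal ..
    finally show ?case .
  qed
qed

text \<open>The action integrates out because each \<open>\<pi> n h\<close> is a probability
  measure: the state marginal of the occupation measure is the sum over times of the laws of the
  state, restricted to \<open>Y\<close>.\<close>

lemma nn_integral_occupation_state:
  assumes \<pi>: "\<pi> \<in> strategies X A" and x: "x \<in> X"
    and f: "f \<in> borel_measurable (stateM Y)"
  shows "(\<integral>\<^sup>+w. f (fst w) \<partial>occupation X Y A p \<pi> x) =
    (\<Sum>n. \<integral>\<^sup>+h. f (snd h) * indicator Y (snd h) \<partial>hist_law X A p \<pi> x n)"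
proof -
  have 1: "(\<lambda>w. f (fst w)) \<in> borel_measurable (stateM Y \<Otimes>\<^sub>M stateM A)"
    using f by measurable
  note 2 = extend_by_0_measurable[OF 1]
  have "(\<integral>\<^sup>+w. f (fst w) * indicator (Y \<times> A) w \<partial>pair_law X A p \<pi> x n) =
     (\<integral>\<^sup>+h. f (snd h) * indicator Y (snd h) \<partial>hist_law X A p \<pi> x n)" for n
  proof -
    have "(\<integral>\<^sup>+a. f (snd h) * indicator (Y \<times> A) (snd h, a) \<partial>\<pi> n h) = f (snd h) * indicator Y (snd h)"
      if "h \<in> space (hist_law X A p \<pi> x n)" for h
    proof -
      have h: "h \<in> space (histM X A n)" using that hist_law_sets \<pi> x by auto
      have "(\<integral>\<^sup>+a. f (snd h) * indicator (Y \<times> A) (snd h, a) \<partial>\<pi> n h) =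
          (\<integral>\<^sup>+a. f (snd h) * indicator Y (snd h) \<partial>\<pi> n h)"
        using strategy_prob(2)[OF \<pi> h] by (intro nn_integral_cong) (auto split: split_indicator)
      then show ?thesis
        using prob_space.emeasure_space_1[OF strategy_prob(3)[OF \<pi> h]] by simp
    qed
    then show ?thesis
      unfolding nn_integral_pair_law[OF \<pi> x 2] by (intro nn_integral_cong) simp
  qed
  then show ?thesis
    by (simp add: nn_integral_occupation[OF \<pi> x 1])
qed

text \<open>This verifies the \<open>vanish\<close> assumption of \<open>vanishing_family\<close>.
  The order of choices matters: uniform absorption fixes the time horizon \<open>N\<close> for all
  strategies and all \<open>n\<close>, and only then is \<open>n\<close> taken large enough for the
  finitely many times before \<open>N\<close>.\<close>

lemma occupation_vanishing:
  assumes F: "finite F" "F \<subseteq> X" and unif: "\<forall>x\<in>F. uniformly_absorbing X A p \<Delta> x"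
    and f: "\<And>n. f n \<in> borel_measurable (stateM Y)" and le: "\<And>n z. z \<in> Y \<Longrightarrow> f n z \<le> 1"
    and dec: "\<And>m n z. z \<in> Y \<Longrightarrow> m \<le> n \<Longrightarrow> f n z \<le> f m z"
    and lim: "\<And>z. z \<in> Y \<Longrightarrow> (\<lambda>n. f n z) \<longlonglongrightarrow> 0"
    and e: "0 < e"
  shows "\<exists>n. \<forall>\<eta>\<in>occupation_set X Y A p F. (\<integral>\<^sup>+w. f n (fst w) \<partial>\<eta>) < e"
proof -
  \<comment> \<open>\<open>T\<close> acts on functions on all of \<open>X\<close>. The value 0 at
    \<open>\<Delta>\<close> matches the restriction to \<open>Y\<close>, and off \<open>Y\<close> it
    supplies the bound, the monotonicity and the limit that are given for \<open>f\<close> only on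
    \<open>Y\<close>.\<close>
  define g where "g n z = f n z * indicator Y z" for n z
  have Y_X: "Y \<inter> space (stateM X) \<in> sets (stateM X)"
    using Y_borel by (auto simp: stateM_def sets_restrict_space X_eq)
  have "X \<in> sets borel" "X \<inter> Y = Y" using Y_borel by (auto simp: X_eq)
  then have YX: "restrict_space (stateM X) Y = stateM Y"
    using Y_borel by (simp add: stateM_def restrict_restrict_space)
  have g: "g n \<in> borel_measurable (stateM X)" for n
    unfolding g_def[abs_def]
    by (rule iffD1[OF borel_measurable_restrict_space_iff_ennreal[OF Y_X]]) (simp only: YX f)
  have g_le: "g n z \<le> 1" for n z using le by (auto simp: g_def split: split_indicator)
  have g_dec: "g n z \<le> g m z" if "m \<le> n" for m n z
    using dec that by (auto simp: g_def split: split_indicator)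
  have g_lim: "(\<lambda>n. g n z) \<longlonglongrightarrow> 0" for z
    using lim by (auto simp: g_def split: split_indicator)
  \<comment> \<open>The estimate is proved for all large \<open>n\<close>, so that the maximum of
    the finitely many thresholds serves every initial state in \<open>F\<close>.\<close>
  have "\<exists>m. \<forall>n\<ge>m. \<forall>\<pi>\<in>strategies X A. (\<integral>\<^sup>+w. f n (fst w) \<partial>occupation X Y A p \<pi> x) < e" if x: "x \<in> F" for x
  proof -
    have xX: "x \<in> X" using x F by auto
    \<comment> \<open>The final estimate is only nonstrict, so \<open>d\<close> is half of a number
      strictly between 0 and \<open>e\<close>; this also covers infinite \<open>e\<close>.\<close>
    obtain d where d: "0 < d" "d + d < e"
    proof -
      obtain r where r: "0 < r" "r < e" using dense[OF e] by blast
      have "r / 2 + r / 2 = r * 2 / 2"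
        by (simp only: add_divide_distrib_ennreal mult_2_right)
      also have "\<dots> = r" by (rule ennreal_mult_divide_eq) auto
      finally have "r / 2 + r / 2 = r" .
      then show ?thesis using that[of "r / 2"] r by (simp add: ennreal_zero_less_divide)
    qed
    have "((\<lambda>n. SUP \<pi>\<in>strategies X A. (\<Sum>t. surv_prob X A p \<Delta> \<pi> x (t + n))) \<longlongrightarrow> 0) sequentially"
      using unif x by (simp add: uniformly_absorbing_def)
    from order_tendstoD(2)[OF this d(1)] obtain N
      where N: "(SUP \<pi>\<in>strategies X A. (\<Sum>t. surv_prob X A p \<Delta> \<pi> x (t + N))) < d"
      by (auto simp: eventually_sequentially)
    have "(\<lambda>n. \<Sum>t<N. (T ^^ t) (g n) x) \<longlonglongrightarrow> (\<Sum>t<N. 0)"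
      using Tpow_decreasing_to_0[of g, OF g g_le g_dec g_lim] xX by (intro tendsto_sum) auto
    then have "\<forall>\<^sub>F n in sequentially. (\<Sum>t<N. (T ^^ t) (g n) x) < d"
      using d(1) by (intro order_tendstoD(2)) auto
    then obtain m where m: "\<And>n. n \<ge> m \<Longrightarrow> (\<Sum>t<N. (T ^^ t) (g n) x) < d"
      by (auto simp: eventually_sequentially)
    have "(\<integral>\<^sup>+w. f n (fst w) \<partial>occupation X Y A p \<pi> x) < e" if n: "n \<ge> m" and \<pi>: "\<pi> \<in> strategies X A" for n \<pi>
    proof -
      define u where "u t = (\<integral>\<^sup>+h. g n (snd h) \<partial>hist_law X A p \<pi> x t)" for t
      have "u t \<le> (\<integral>\<^sup>+h. indicator Y (snd h) \<partial>hist_law X A p \<pi> x t)" for t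
        unfolding u_def using le by (intro nn_integral_mono) (auto simp: g_def split: split_indicator)
      then have u_le: "u t \<le> surv_prob X A p \<Delta> \<pi> x t" for t
        using occupied_le_surv_prob[OF \<pi> xX] order_trans by blast
      have "(\<integral>\<^sup>+w. f n (fst w) \<partial>occupation X Y A p \<pi> x) = (\<Sum>t. u t)"
        unfolding nn_integral_occupation_state[OF \<pi> xX f] u_def g_def ..
      also have "\<dots> = (\<Sum>t. u (t + N)) + (\<Sum>t<N. u t)"
        by (rule suminf_offset) simp
      \<comment> \<open>From time \<open>N\<close> on, \<open>f n \<le> 1\<close> reduces each term
        to survival; before \<open>N\<close>, the powers of \<open>T\<close> give the bound.\<close>
      also have "\<dots> \<le> (\<Sum>t. surv_prob X A p \<Delta> \<pi> x (t + N)) + (\<Sum>t<N. (T ^^ t) (g n) x)"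
        using u_le nn_integral_state_le_Tpow[OF \<pi> xX g g_le]
        by (intro add_mono suminf_le sum_mono) (auto simp: u_def)
      also have "\<dots> \<le> d + d"
        using m[OF n] N SUP_upper[OF \<pi>, of "\<lambda>\<pi>. \<Sum>t. surv_prob X A p \<Delta> \<pi> x (t + N)"]
        by (intro add_mono) auto
      finally show ?thesis using d(2) by simp
    qed
    then show ?thesis by blast
  qed
  then obtain m where m: "\<And>x n \<pi>. x \<in> F \<Longrightarrow> n \<ge> m x \<Longrightarrow> \<pi> \<in> strategies X A \<Longrightarrow>
      (\<integral>\<^sup>+w. f n (fst w) \<partial>occupation X Y A p \<pi> x) < e" by metis
  have "m x \<le> Max (m ` F)" if "x \<in> F" for x using F(1) that by simp
  then show ?thesis
    using m by (intro exI[of _ "Max (m ` F)"]) (auto simp: occupation_set_def)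
qed

end

theorem theorem1:
  fixes Y :: "'x::polish_space set" and \<Delta> :: 'x and A :: "'a::polish_space set"
    and p :: "'x \<Rightarrow> 'a \<Rightarrow> 'x measure" and F :: "'x set"
  assumes Y_borel: "Y \<in> sets borel"
    and Delta_notin: "\<Delta> \<notin> Y"
    and Delta_isolated: "openin (top_of_set (Y \<union> {\<Delta>})) {\<Delta>}"
    and A_borel: "A \<in> sets borel" and A_ne: "A \<noteq> {}"
    and p_kernel: "(\<lambda>(x, a). p x a) \<in> measurable (stateM (Y \<union> {\<Delta>}) \<Otimes>\<^sub>M stateM A)
                     (prob_algebra (stateM (Y \<union> {\<Delta>})))"
    and Delta_absorb: "\<forall>a\<in>A. emeasure (p \<Delta> a) {\<Delta>} = 1"
    and S: "condition_S (Y \<union> {\<Delta>}) A p"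
    and F_fin: "finite F" and F_ne: "F \<noteq> {}" and F_sub: "F \<subseteq> Y \<union> {\<Delta>}"
    and unif: "\<forall>x\<in>F. uniformly_absorbing (Y \<union> {\<Delta>}) A p \<Delta> x"
  shows "subtopology (w_topology Y A) (occupation_set (Y \<union> {\<Delta>}) Y A p F) =
         subtopology (ws_topology Y A) (occupation_set (Y \<union> {\<Delta>}) Y A p F)"
proof -
  interpret mdp "Y \<union> {\<Delta>}" Y \<Delta> A p
    by unfold_locales (use Y_borel Delta_notin p_kernel Delta_absorb S in auto)
  interpret vanishing_family Y A "occupation_set (Y \<union> {\<Delta>}) Y A p F"
  proof
    show "compact A" using S by (simp add: condition_S_def)
    show "sets \<eta> = sets (stateM Y \<Otimes>\<^sub>M stateM A)" if "\<eta> \<in> occupation_set (Y \<union> {\<Delta>}) Y A p F" for \<eta>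
      using that by (auto simp: occupation_set_def occupation_def)
  qed (fact Y_borel, rule occupation_vanishing[OF F_fin F_sub unif])
  show ?thesis by (rule w_ws_topologies_agree)
qed

end
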